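(* For every integer $m\geq 1$, $$\tau(m) = \frac{-20\,m^{11}}{m-\frac{5}{6}}\,L_{\Delta,m}(11),\qquad\text{where}\quad L_{\Delta,m}(11)=\sum_{n\geq 1}\frac{\tau(n+m)\sigma(n)}{(n+m)^{11}}.$$
   Context: Here $\tau$ is the Ramanujan tau function, i.e. $\Delta(z)=\sum_{n\geq 1}\tau(n)q^n$ ($q=e^{2\pi i z}$) is the unique normalized cusp form of weight $12$ for $SL_2(\mathbb{Z})$, and $\sigma(n)=\sum_{d\mid n}d$. The series defining $L_{\Delta,m}(11)$ converges absolutely. *)

theory Defs
  imports "HOL-Complex_Analysis.Complex_Analysis"
begin

definition upper_half_plane :: "complex set" where
  "upper_half_plane = {z. Im z > 0}"

definition has_q_expansion :: "(complex \<Rightarrow> complex) \<Rightarrow> (nat \<Rightarrow> complex) \<Rightarrow> bool" where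
  "has_q_expansion f a \<longleftrightarrow>
     (\<forall>z\<in>upper_half_plane. (\<lambda>n. a n * exp (2 * of_real pi * \<i> * z) ^ n) sums f z)"

(* Only the values of f on the upper half plane matter. *)
definition modular_form :: "int \<Rightarrow> (complex \<Rightarrow> complex) \<Rightarrow> bool" where
  "modular_form k f \<longleftrightarrow>
     f holomorphic_on upper_half_plane \<and>
     (\<forall>a b c d :: int. a * d - b * c = 1 \<longrightarrow>
        (\<forall>z\<in>upper_half_plane.
           f ((of_int a * z + of_int b) / (of_int c * z + of_int d)) =
             (of_int c * z + of_int d) powi k * f z)) \<and>
     (\<exists>a. has_q_expansion f a)"

definition normalized_cusp_form :: "int \<Rightarrow> (complex \<Rightarrow> complex) \<Rightarrow> (nat \<Rightarrow> complex) \<Rightarrow> bool" where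
  "normalized_cusp_form k f a \<longleftrightarrow>
     modular_form k f \<and> has_q_expansion f a \<and> a 0 = 0 \<and> a 1 = 1"

(* The description ranges over the coefficient sequence rather than over the form itself:
   the values of f off the upper half plane are arbitrary, the coefficients are not. *)
definition ramanujan_tau :: "nat \<Rightarrow> complex" where
  "ramanujan_tau = (THE a. \<exists>f. normalized_cusp_form 12 f a)"

definition divisor_sigma :: "nat \<Rightarrow> nat" where
  "divisor_sigma n = (\<Sum>d | d dvd n. d)"

definition L_Delta_term :: "nat \<Rightarrow> nat \<Rightarrow> nat \<Rightarrow> complex" where
  "L_Delta_term m s n =
     ramanujan_tau (n + m) * of_nat (divisor_sigma n) / of_nat (n + m) ^ s"

(* infsum on complex numbers is the absolutely convergent (unconditional) sum,
   with value 0 if the family is not summable. *)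
definition L_Delta :: "nat \<Rightarrow> nat \<Rightarrow> complex" where
  "L_Delta m s = (\<Sum>\<^sub>\<infinity>n\<in>{1..}. L_Delta_term m s n)"

end

theory Submission
  imports Defs
begin

text \<open>
  Write q = exp (2 \<pi> i z), j = c z + d for the automorphy factor of \<gamma>, and
  P_k,N(z) for the Poincare series, the sum of j^(-k) exp (2 \<pi> i N \<gamma>z) over the cosets \<gamma> of
  the translations in SL(2,Z).  Weight 10 carries no nonzero cusp form, so P_10,m = 0 for
  m \<ge> 1.  The Serre derivative D - (10/12) E_2, with D = (2 \<pi> i)^(-1) d/dz and
  E_2 = 1 - 24 \<Sum> \<sigma>(n) q^n, raises weight 10 to weight 12 and commutes with the two slash
  actions.  It therefore maps P_10,m to the weight 12 series whose seed is
  (m - (5/6) E_2) q^m = (m - 5/6) q^m + 20 \<Sum> \<sigma>(n) q^(n+m), that is,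
  (m - 5/6) P_12,m + 20 \<Sum> \<sigma>(n) P_12,n+m = 0.  Cusp forms of weight 12 are multiples
  of \<Delta>, and P_12,N equals P_12,1 times \<tau>(N) / N^11.  Evaluating at a point where P_12,1 does not vanish, and
  dividing by its value there, gives the identity.

  The dependence of P_k,N on N is usually read off from the Petersson product.  Here it comes
  instead from the kernel K_k(z,w), the sum of (a z + b + w (c z + d))^(-k) over all of
  SL(2,Z).  Summing over the translations first, Lipschitz's formula shows that K_k(z,w) is, up to
  a constant, the generating series of N^(k-1) P_k,N(z) in the variable q of w.  On the
  other hand K_k(z,w) has weight k in w.  So K_10 = 0, and K_12(z,w) is a multiple of \<Delta>(w);
  comparing coefficients yields P_10,N = 0 and the formula for P_12,N (theorems
  Poincare_10_eq_0 and Poincare_12).  No series has to be differentiated for the Serre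
  derivative either: the absolutely convergent sum of (a + c w) (a z + b + w (c z + d))^(-11),
  which is proportional to the z-derivative of K_10, is evaluated in two ways
  (SL2_kernel_deriv_eq_0 and Poincare_deriv_eq).

  Both the vanishing in weight 10 and the one-dimensionality in weight 12 rest on a nowhere
  vanishing \<Delta>, defined as q exp (-24 \<Sum> \<sigma>(n) q^n / n), whose logarithmic derivative is
  2 \<pi> i E_2.  Its behaviour under z \<mapsto> -1/z follows from that of E_2 (theorem E2_S), obtained by
  exchanging the order of summation in a conditionally convergent Eisenstein series.  A quotient of
  weight 0 of powers of a cusp form and of \<Delta> is a holomorphic function of q in the unit disc invariant under
  z \<mapsto> -1/z, hence constant by the maximum modulus principle (invariant_imp_constant).
  Full modularity of \<Delta> is not proved from generators of SL(2,Z) but inherited from K_12, once P_12,1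
  is known to be nonzero at z = i (Poincare_12_1_nonzero).
\<close>

section \<open>The parameter q and lattice sums\<close>

definition qexp :: "complex \<Rightarrow> complex" where
  "qexp z = exp (2 * of_real pi * \<i> * z)"

lemma qexp_add: "qexp (z + w) = qexp z * qexp w"
  by (simp add: qexp_def ring_distribs exp_add)

lemma qexp_power: "qexp z ^ n = qexp (of_nat n * z)"
  by (simp add: qexp_def exp_of_nat_mult [symmetric] mult_ac)

lemma qexp_nonzero [simp]: "qexp z \<noteq> 0"
  by (simp add: qexp_def)

lemma norm_qexp: "norm (qexp z) = exp (- 2 * pi * Im z)"
  by (simp add: qexp_def norm_exp_eq_Re)

lemma norm_qexp_less_1: "Im z > 0 \<Longrightarrow> norm (qexp z) < 1"
  by (simp add: norm_qexp)

lemma qexp_of_int [simp]: "qexp (of_int n) = 1"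
  using exp_integer_2pi[of "of_int n"] by (simp add: qexp_def mult_ac)

lemma qexp_add_int: "qexp (z + of_int n) = qexp z"
  by (simp add: qexp_add)

lemma qexp_surj:
  assumes "u \<noteq> 0" "norm u < 1"
  obtains z where "Im z > 0" "qexp z = u"
proof
  let ?z = "Ln u / (2 * of_real pi * \<i>)"
  show "qexp ?z = u" using assms by (simp add: qexp_def)
  have "exp (- 2 * pi * Im ?z) < 1" using assms \<open>qexp ?z = u\<close> norm_qexp by metis
  then show "Im ?z > 0" by (simp add: zero_less_mult_iff)
qed

lemma has_field_derivative_qexp [derivative_intros]:
  "(qexp has_field_derivative 2 * of_real pi * \<i> * qexp z) (at z within A)"
  unfolding qexp_def [abs_def] by (auto intro!: derivative_eq_intros)

lemma Im_moebius_pos: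
  fixes a b c d :: int
  assumes "Im z > 0" "a * d - b * c = 1"
  shows "of_int c * z + of_int d \<noteq> 0"
    "Im ((of_int a * z + of_int b) / (of_int c * z + of_int d)) = Im z / norm (of_int c * z + of_int d) ^ 2"
    "Im ((of_int a * z + of_int b) / (of_int c * z + of_int d)) > 0"
proof -
  have nz: "c \<noteq> 0 \<or> d \<noteq> 0" using assms(2) by auto
  show 1: "of_int c * z + of_int d \<noteq> 0"
  proof
    assume *: "of_int c * z + of_int d = 0"
    from arg_cong[OF *, of Im] have "c = 0" using assms by simp
    with * nz show False by simp
  qed
  have det: "real_of_int a * of_int d - of_int b * of_int c = 1"
    using arg_cong[OF assms(2), of real_of_int] by simp
  show 2: "Im ((of_int a * z + of_int b) / (of_int c * z + of_int d)) = Im z / norm (of_int c * z + of_int d) ^ 2"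
  proof -
    have "Im ((of_int a * z + of_int b) / (of_int c * z + of_int d))
       = (of_int a * Im z * (of_int c * Re z + of_int d) - (of_int a * Re z + of_int b) * (of_int c * Im z))
          / norm (of_int c * z + of_int d) ^ 2"
      by (simp add: Im_divide cmod_power2)
    also have "of_int a * Im z * (of_int c * Re z + of_int d) - (of_int a * Re z + of_int b) * (of_int c * Im z)
       = (of_int a * of_int d - of_int b * of_int c) * Im z"
      by (simp add: algebra_simps)
    finally show ?thesis by (simp add: det)
  qed
  show "Im ((of_int a * z + of_int b) / (of_int c * z + of_int d)) > 0"
    unfolding 2 using assms(1) 1 by simp
qed

lemma lattice_form_nonzero:
  fixes c d :: int
  assumes "Im z > 0" "c \<noteq> 0 \<or> d \<noteq> 0"
  shows "of_int c * z + of_int d \<noteq> 0"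
proof
  assume *: "of_int c * z + of_int d = 0"
  from arg_cong[OF *, of Im] have "c = 0" using assms by simp
  with * assms show False by simp
qed

text \<open>
  The imaginary part controls c, and then d = (c z + d) - c z controls d.  The
  convergence of lattice sums is reduced to this comparison of norms on R^2.
\<close>

lemma lattice_form_bound:
  assumes "Im z > 0"
  obtains \<kappa> :: real where "\<kappa> > 0"
    "\<And>c d :: int. \<bar>of_int c\<bar> \<le> \<kappa> * norm (of_int c * z + of_int d)"
    "\<And>c d :: int. \<bar>of_int d\<bar> \<le> \<kappa> * norm (of_int c * z + of_int d)"
proof
  let ?\<kappa> = "1 / Im z + (1 + norm z / Im z)"
  show "?\<kappa> > 0" using assms by (intro add_pos_nonneg) auto
  fix c d :: int
  let ?j = "of_int c * z + of_int d"
  have "\<bar>of_int c\<bar> * Im z = \<bar>Im ?j\<bar>" using assms by (simp add: abs_mult)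
  also have "\<dots> \<le> norm ?j" by (rule abs_Im_le_cmod)
  finally have c: "\<bar>real_of_int c\<bar> \<le> 1 / Im z * norm ?j" using assms by (simp add: field_simps)
  also have "\<dots> \<le> ?\<kappa> * norm ?j" using assms by (intro mult_right_mono) auto
  finally show "\<bar>real_of_int c\<bar> \<le> ?\<kappa> * norm ?j" .
  have "\<bar>real_of_int d\<bar> = norm (?j - of_int c * z)" by simp
  also have "\<dots> \<le> norm ?j + \<bar>of_int c\<bar> * norm z"
    by (metis norm_triangle_ineq4 norm_mult norm_of_int)
  also have "\<dots> \<le> norm ?j + (1 / Im z * norm ?j) * norm z"
    by (intro add_left_mono mult_right_mono c) auto
  also have "\<dots> = (1 + norm z / Im z) * norm ?j" by (simp add: algebra_simps)
  also have "\<dots> \<le> ?\<kappa> * norm ?j" using assms by (intro mult_right_mono) auto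
  finally show "\<bar>real_of_int d\<bar> \<le> ?\<kappa> * norm ?j" .
qed

lemma int_sum_split:
  fixes f :: "int \<Rightarrow> 'a :: {topological_comm_monoid_add, t2_space}"
  assumes "((\<lambda>n. f (int n)) has_sum S) UNIV" "((\<lambda>n. f (- int (Suc n))) has_sum T) UNIV"
  shows "(f has_sum (S + T)) UNIV"
proof -
  have 1: "(f has_sum S) (range int)"
    using assms(1) by (subst has_sum_reindex) (auto simp: o_def)
  have 2: "(f has_sum T) (range (\<lambda>n. - int (Suc n)))"
    using assms(2) by (subst has_sum_reindex) (auto simp: o_def inj_on_def)
  have "range int \<union> range (\<lambda>n. - int (Suc n)) = UNIV"
  proof (intro equalityI subsetI UNIV_I)
    fix x :: int
    show "x \<in> range int \<union> range (\<lambda>n. - int (Suc n))"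
      by (cases x) auto
  qed
  moreover have "range int \<inter> range (\<lambda>n. - int (Suc n)) = {}"
    by auto
  ultimately show ?thesis using has_sum_Un_disjoint[OF 1 2] by simp
qed

lemma summable_on_product_nonneg:
  fixes f :: "'a \<Rightarrow> real" and g :: "'b \<Rightarrow> real"
  assumes "f summable_on A" "g summable_on B" "\<And>x. x \<in> A \<Longrightarrow> f x \<ge> 0" "\<And>y. y \<in> B \<Longrightarrow> g y \<ge> 0"
  shows "(\<lambda>(x,y). f x * g y) summable_on A \<times> B"
proof (rule summable_on_SigmaI)
  show "((\<lambda>y. case (x, y) of (x, y) \<Rightarrow> f x * g y) has_sum f x * infsum g B) B" for x
    using assms(2) by (simp add: has_sum_cmult_right)
  show "(\<lambda>x. f x * infsum g B) summable_on A"
    using assms(1) by (rule summable_on_cmult_left)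
qed (use assms in auto)

lemma summable_on_nat_powr: "(\<lambda>n::nat. (1 + real n) powr (-3/2)) summable_on UNIV"
proof -
  have "summable (\<lambda>n. real n powr (-3/2))" by (subst summable_real_powr_iff) simp
  then have "summable (\<lambda>n. real (Suc n) powr (-3/2))" by (subst summable_Suc_iff)
  then show ?thesis
    by (intro summable_nonneg_imp_summable_on) (auto simp: add_ac)
qed

lemma summable_on_int_powr: "(\<lambda>n::int. (1 + \<bar>of_int n\<bar>) powr (-3/2) :: real) summable_on UNIV"
proof -
  have 1: "((\<lambda>n. (1 + \<bar>of_int (int n)\<bar>) powr (-3/2) :: real) has_sum (\<Sum>\<^sub>\<infinity>n. (1 + real n) powr (-3/2))) UNIV"
    using summable_on_nat_powr by simp
  have "(\<lambda>n::nat. (1 + \<bar>of_int (- int (Suc n))\<bar>) powr (-3/2) :: real) summable_on UNIV"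
    by (rule summable_on_comparison_test[OF summable_on_nat_powr]) (auto intro!: powr_mono2')
  then show ?thesis
    by (intro has_sum_imp_summable[OF int_sum_split[OF 1]]) (rule has_sum_infsum)
qed

text \<open>
  Since max(|c|,|d|) \<ge> 1 off the origin, (1 + |c|) (1 + |d|) is at most a constant times
  |c z + d|^2, so the third power is dominated by a product of two convergent one-dimensional
  series.  Larger powers are smaller up to a constant, as |c z + d| is bounded below.  At the origin the summand is 1/0 = 0, which is why the sum may range over all pairs.
\<close>

lemma summable_lattice:
  assumes z: "Im z > 0" and p: "p \<ge> 3"
  shows "(\<lambda>(c,d). 1 / norm (of_int c * z + of_int d) ^ p) summable_on (UNIV :: (int \<times> int) set)"
proof -
  obtain \<kappa> where \<kappa>: "\<kappa> > 0"
    "\<And>c d :: int. \<bar>of_int c\<bar> \<le> \<kappa> * norm (of_int c * z + of_int d)"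
    "\<And>c d :: int. \<bar>of_int d\<bar> \<le> \<kappa> * norm (of_int c * z + of_int d)"
    using lattice_form_bound[OF z] by metis
  let ?g = "\<lambda>n::int. (1 + \<bar>of_int n\<bar>) powr (-3/2) :: real"
  have "(\<lambda>(c,d). ?g c * ?g d) summable_on (UNIV \<times> UNIV)"
    by (intro summable_on_product_nonneg summable_on_int_powr) auto
  then have sm: "(\<lambda>x. (2*\<kappa>)^p * (case x of (c,d) \<Rightarrow> ?g c * ?g d)) summable_on UNIV"
    by (intro summable_on_cmult_right) simp
  show ?thesis
  proof (rule summable_on_comparison_test[OF sm], goal_cases)
    case (1 x)
    obtain c d where x: "x = (c,d)" by force
    show ?case
    proof (cases "c = 0 \<and> d = 0")
      case True
      then show ?thesis using p x \<kappa> by (auto simp: zero_power)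
    next
      case False
      let ?n = "norm (of_int c * z + of_int d)"
      have np: "?n > 0" using lattice_form_nonzero[OF z] False by simp
      have "1 \<le> \<bar>real_of_int c\<bar> \<or> 1 \<le> \<bar>real_of_int d\<bar>" using False by linarith
      then have one: "1 \<le> \<kappa> * ?n" using \<kappa>(2)[of c d] \<kappa>(3)[of d c] by linarith
      have A: "1 + \<bar>real_of_int c\<bar> \<le> 2*\<kappa>*?n" "1 + \<bar>real_of_int d\<bar> \<le> 2*\<kappa>*?n"
        using one \<kappa>(2)[of c d] \<kappa>(3)[of d c] by linarith+
      have pos: "2*\<kappa>*?n > 0" using \<kappa> np by simp
      have "(2*\<kappa>*?n) powr (-3/2) * (2*\<kappa>*?n) powr (-3/2) \<le> ?g c * ?g d"
        using A pos by (intro mult_mono powr_mono2') auto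
      also have "(2*\<kappa>*?n) powr (-3/2) * (2*\<kappa>*?n) powr (-3/2) = (2*\<kappa>*?n) powr (-3)"
        by (simp add: powr_add [symmetric])
      finally have B: "(2*\<kappa>*?n) powr (-3) \<le> ?g c * ?g d" .
      have "1 / (2*\<kappa>*?n)^p \<le> 1 / (2*\<kappa>*?n)^3"
        using pos p one \<kappa>(1) by (intro divide_left_mono power_increasing mult_pos_pos zero_less_power) auto
      also have "\<dots> = (2*\<kappa>*?n) powr (-3)"
        using pos powr_minus_divide[of "2*\<kappa>*?n" 3] powr_realpow[of "2*\<kappa>*?n" 3] by simp
      finally have "1 / (2*\<kappa>*?n)^p \<le> ?g c * ?g d" using B by linarith
      then have "1 / ?n ^ p \<le> (2*\<kappa>)^p * (?g c * ?g d)"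
        using \<kappa> np by (simp add: field_simps)
      then show ?thesis using x by simp
    qed
  qed (auto simp: case_prod_unfold)
qed

lemma summable_int_translates:
  assumes z: "Im z > 0" and p: "p \<ge> 2"
  shows "(\<lambda>n::int. 1 / norm (z + of_int n) ^ p) summable_on UNIV"
proof -
  obtain \<kappa> where \<kappa>: "\<kappa> > 0"
    "\<And>c d :: int. \<bar>of_int c\<bar> \<le> \<kappa> * norm (of_int c * z + of_int d)"
    "\<And>c d :: int. \<bar>of_int d\<bar> \<le> \<kappa> * norm (of_int c * z + of_int d)"
    using lattice_form_bound[OF z] by metis
  have sm: "(\<lambda>n::int. (2*\<kappa>)^p * (1 + \<bar>of_int n\<bar>) powr (-3/2)) summable_on UNIV"
    by (intro summable_on_cmult_right summable_on_int_powr)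
  show ?thesis
  proof (rule summable_on_comparison_test[OF sm], goal_cases)
    case (1 n)
    let ?n = "norm (z + of_int n)"
    have np: "?n > 0" using lattice_form_nonzero[OF z, of 1 n] by simp
    have A: "1 + \<bar>real_of_int n\<bar> \<le> 2*\<kappa>*?n" and one: "1 \<le> \<kappa> * ?n"
      using \<kappa>(2)[of 1 n] \<kappa>(3)[of n 1] by simp_all
    have pos: "2*\<kappa>*?n > 0" using \<kappa> np by simp
    have "1 / (2*\<kappa>*?n)^p \<le> 1 / (2*\<kappa>*?n)^2"
      using pos p one \<kappa>(1) by (intro divide_left_mono power_increasing mult_pos_pos zero_less_power) auto
    also have "\<dots> = (2*\<kappa>*?n) powr (-2)"
      using pos powr_minus_divide[of "2*\<kappa>*?n" 2] powr_realpow[of "2*\<kappa>*?n" 2] by simp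
    also have "\<dots> \<le> (2*\<kappa>*?n) powr (-3/2)" using one by (intro powr_mono) auto
    also have "\<dots> \<le> (1 + \<bar>of_int n\<bar>) powr (-3/2)" using A by (intro powr_mono2') auto
    finally have "1 / (2*\<kappa>*?n)^p \<le> (1 + \<bar>of_int n\<bar>) powr (-3/2)" .
    then show ?case
      using \<kappa> np by (simp add: field_simps)
  qed auto
qed

section \<open>The Lipschitz summation formula\<close>

lemma summable_npower:
  fixes u :: complex
  assumes "norm u < 1"
  shows "summable (\<lambda>n. of_nat n ^ k * u ^ n)"
  using assms
proof (induction k arbitrary: u)
  case 0
  then show ?case by (simp add: summable_geometric)
next
  case (Suc k)
  have "summable (\<lambda>n. diffs (\<lambda>n. of_nat n ^ k) n * u ^ n)"
    by (rule termdiff_converges[OF Suc.prems]) (use Suc.IH in auto)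
  then have "summable (\<lambda>n. u * (diffs (\<lambda>n. of_nat n ^ k) n * u ^ n))" by (rule summable_mult)
  then have "summable (\<lambda>n. of_nat (Suc n) ^ Suc k * u ^ Suc n)"
    by (simp add: diffs_def mult_ac)
  then show ?case by (subst (asm) summable_Suc_iff)
qed

lemma diffs_series_shift:
  fixes u :: complex
  assumes "summable (\<lambda>n. diffs c n * u ^ n)"
  shows "u * (\<Sum>n. diffs c n * u ^ n) = (\<Sum>n. of_nat n * c n * u ^ n)"
proof -
  have "(\<lambda>n. u * (diffs c n * u ^ n)) sums (u * (\<Sum>n. diffs c n * u ^ n))"
    using assms by (intro sums_mult summable_sums)
  then have "(\<lambda>n. of_nat (Suc n) * c (Suc n) * u ^ Suc n) sums (u * (\<Sum>n. diffs c n * u ^ n))"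
    by (simp add: diffs_def mult_ac)
  then have "(\<lambda>n. of_nat n * c n * u ^ n) sums (u * (\<Sum>n. diffs c n * u ^ n))"
    by (subst (asm) sums_Suc_iff) simp
  then show ?thesis by (simp add: sums_iff)
qed

lemma has_field_derivative_qseries:
  assumes "\<And>u :: complex. norm u < 1 \<Longrightarrow> summable (\<lambda>n. c n * u ^ n)" and "Im z > 0"
  shows "((\<lambda>z. \<Sum>n. c n * qexp z ^ n) has_field_derivative
            2 * of_real pi * \<i> * (\<Sum>n. of_nat n * c n * qexp z ^ n)) (at z)"
proof -
  have n: "norm (qexp z) < 1" using assms norm_qexp_less_1 by blast
  have "((\<lambda>u. \<Sum>n. c n * u^n) has_field_derivative (\<Sum>n. diffs c n * qexp z^n)) (at (qexp z))"
    by (rule termdiffs_strong'[OF _ n]) (use assms in auto)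
  from DERIV_chain2[OF this has_field_derivative_qexp]
  have D: "((\<lambda>z. \<Sum>n. c n * qexp z ^ n) has_field_derivative
          (\<Sum>n. diffs c n * qexp z^n) * (2 * of_real pi * \<i> * qexp z)) (at z)" .
  have "qexp z * (\<Sum>n. diffs c n * qexp z ^ n) = (\<Sum>n. of_nat n * c n * qexp z ^ n)"
    by (intro diffs_series_shift termdiff_converges[OF n]) (use assms in auto)
  then have "2 * of_real pi * \<i> * (\<Sum>n. of_nat n * c n * qexp z ^ n) =
     (\<Sum>n. diffs c n * qexp z^n) * (2 * of_real pi * \<i> * qexp z)"
    by (metis mult.assoc mult.commute)
  then show ?thesis by (simp only: D)
qed

text \<open>
  The series \<Sum> n^k q^n, with 0^0 = 1: for k = 0 the constant term 1 is included, for k \<ge> 1 the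
  sum starts at n = 1.
\<close>

definition npow_series :: "nat \<Rightarrow> complex \<Rightarrow> complex" where
  "npow_series k z = (\<Sum>n. of_nat n ^ k * qexp z ^ n)"

lemma has_field_derivative_npow_series:
  assumes "Im z > 0"
  shows "(npow_series k has_field_derivative 2 * of_real pi * \<i> * npow_series (Suc k) z) (at z)"
  using has_field_derivative_qseries[OF summable_npower assms, of k]
  unfolding npow_series_def [abs_def] by (simp add: mult_ac)

lemma not_Ints_of_Im: "Im z \<noteq> 0 \<Longrightarrow> z \<notin> \<int>" "Im z \<noteq> 0 \<Longrightarrow> z \<notin> \<int>\<^sub>\<le>\<^sub>0"
  using complex_Im_of_int by (auto elim!: Ints_cases nonpos_Ints_cases)

text \<open>
  This is the expansion of \<pi> cot (\<pi> z) in q, the logarithmic derivative of Euler's reflection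
  formula \<Gamma>(z) \<Gamma>(1 - z) = \<pi> / sin (\<pi> z).
\<close>

lemma Digamma_reflection:
  assumes z: "Im z > 0"
  shows "Digamma (1 - z) - Digamma z = of_real pi * \<i> - 2 * of_real pi * \<i> * npow_series 0 z"
proof -
  have ni: "z \<notin> \<int>\<^sub>\<le>\<^sub>0" "1 - z \<notin> \<int>\<^sub>\<le>\<^sub>0" using z by (auto intro!: not_Ints_of_Im)
  have s0: "sin (of_real pi * z) \<noteq> 0"
    using z by (auto simp: sin_eq_0 complex_eq_iff[of "of_real pi * z"])
  have eq: "(\<lambda>z. Gamma z * Gamma (1 - z)) = (\<lambda>z. of_real pi / sin (of_real pi * z :: complex))"
    by (intro ext Gamma_reflection_complex)
  have "((\<lambda>z. Gamma z * Gamma (1 - z)) has_field_derivative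
          (Gamma z * Digamma z) * Gamma (1 - z) + (Gamma (1-z) * Digamma (1-z) * (-1)) * Gamma z) (at z)"
    using ni by (auto intro!: derivative_eq_intros)
  moreover have "((\<lambda>z. of_real pi / sin (of_real pi * z :: complex)) has_field_derivative
          - (of_real pi ^ 2 * cos (of_real pi * z)) / sin (of_real pi * z) ^ 2) (at z)"
    using s0 by (auto intro!: derivative_eq_intros simp: power2_eq_square)
  ultimately have "(Gamma z * Digamma z) * Gamma (1 - z) + (Gamma (1-z) * Digamma (1-z) * (-1)) * Gamma z =
      - (of_real pi ^ 2 * cos (of_real pi * z)) / sin (of_real pi * z) ^ 2"
    unfolding eq using DERIV_unique by blast
  then have "(Gamma z * Gamma (1 - z)) * (Digamma (1 - z) - Digamma z) =
      of_real pi ^ 2 * cos (of_real pi * z) / sin (of_real pi * z) ^ 2"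
    by (simp add: algebra_simps)
  then have *: "of_real pi / S * (Digamma (1 - z) - Digamma z) = of_real pi ^ 2 * C / S ^ 2"
      if "S = sin (of_real pi * z)" "C = cos (of_real pi * z)" for S C
    using that by (simp add: Gamma_reflection_complex)
  have D: "Digamma (1 - z) - Digamma z = of_real pi * cos (of_real pi * z) / sin (of_real pi * z)"
  proof -
    define D S C where "D = Digamma (1 - z) - Digamma z" "S = sin (of_real pi * z)" "C = cos (of_real pi * z)"
    have "of_real pi / S * D = of_real pi ^ 2 * C / S ^ 2" using *[of S C] by (simp add: D_S_C_def)
    moreover have "S \<noteq> 0" using s0 by (simp add: D_S_C_def)
    ultimately have "D = of_real pi * C / S" by (simp add: divide_simps power2_eq_square)
    then show ?thesis by (simp add: D_S_C_def)
  qed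
  define E where "E = exp (\<i> * (of_real pi * z))"
  have E0: "E \<noteq> 0" by (simp add: E_def)
  have EE: "qexp z = E * E" by (simp add: qexp_def E_def exp_add [symmetric] algebra_simps)
  have n1: "norm (qexp z) < 1" using norm_qexp_less_1 z .
  have ne: "E * E \<noteq> 1" using n1 EE by auto
  have "exp (- (\<i> * (of_real pi * z))) = 1 / E" by (simp add: E_def exp_minus field_simps)
  then have sc: "sin (of_real pi * z) = (E - 1 / E) / (2 * \<i>)" "cos (of_real pi * z) = (E + 1 / E) / 2"
    by (simp_all add: sin_exp_eq cos_exp_eq E_def)
  have "npow_series 0 z = 1 / (1 - E * E)"
    unfolding npow_series_def using suminf_geometric[OF n1] EE by simp
  then have "of_real pi * \<i> - 2 * of_real pi * \<i> * npow_series 0 z = of_real pi * (\<i> - 2 * \<i> / (1 - E * E))"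
    by (simp add: algebra_simps)
  also have "\<i> - 2 * \<i> / (1 - E * E) = ((E + 1 / E) / 2) / ((E - 1 / E) / (2 * \<i>))"
    using ne E0 by (simp add: field_simps)
  finally show ?thesis unfolding D sc by (simp only: times_divide_eq_right)
qed

text \<open>
  Repeated differentiation of the cotangent expansion; each derivative multiplies the coefficient of
  q^n by 2 \<pi> i n.
\<close>

lemma Polygamma_reflection:
  assumes z: "Im z > 0"
  shows "(-1) ^ Suc k * Polygamma (Suc k) (1 - z) - Polygamma (Suc k) z
            = - ((2 * of_real pi * \<i>) ^ (k+2)) * npow_series (Suc k) z"
  using z
proof (induction k arbitrary: z)
  case 0
  have ni: "z \<notin> \<int>\<^sub>\<le>\<^sub>0" "1 - z \<notin> \<int>\<^sub>\<le>\<^sub>0" using 0 by (auto intro!: not_Ints_of_Im)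
  have "((\<lambda>z. Digamma (1 - z) - Digamma z) has_field_derivative
          - Polygamma 1 (1 - z) - Polygamma 1 z) (at z)"
    using ni by (auto intro!: derivative_eq_intros)
  then have "((\<lambda>z. of_real pi * \<i> - 2 * of_real pi * \<i> * npow_series 0 z) has_field_derivative
          - Polygamma 1 (1 - z) - Polygamma 1 z) (at z)"
    by (rule has_field_derivative_transform_within_open[where S = "{z. Im z > 0}"])
       (use 0 Digamma_reflection in \<open>auto simp: open_halfspace_Im_gt\<close>)
  moreover have "((\<lambda>z. of_real pi * \<i> - 2 * of_real pi * \<i> * npow_series 0 z) has_field_derivative
      - (2 * of_real pi * \<i> * (2 * of_real pi * \<i> * npow_series 1 z))) (at z)"
    using 0 by (auto intro!: derivative_eq_intros has_field_derivative_npow_series)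
  ultimately have "- Polygamma 1 (1 - z) - Polygamma 1 z = - (2 * of_real pi * \<i> * (2 * of_real pi * \<i> * npow_series 1 z))"
    by (rule DERIV_unique)
  then show ?case by (simp add: power2_eq_square mult_ac)
next
  case (Suc k)
  have ni: "z \<notin> \<int>\<^sub>\<le>\<^sub>0" "1 - z \<notin> \<int>\<^sub>\<le>\<^sub>0" using Suc.prems by (auto intro!: not_Ints_of_Im)
  let ?F = "\<lambda>z. - ((2 * of_real pi * \<i>) ^ (k+2)) * npow_series (Suc k) z"
  have "((\<lambda>z. (-1) ^ Suc k * Polygamma (Suc k) (1 - z) - Polygamma (Suc k) z) has_field_derivative
          (-1) ^ Suc k * (- Polygamma (Suc (Suc k)) (1 - z)) - Polygamma (Suc (Suc k)) z) (at z)"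
    using ni by (auto intro!: derivative_eq_intros)
  then have "(?F has_field_derivative
          (-1) ^ Suc k * (- Polygamma (Suc (Suc k)) (1 - z)) - Polygamma (Suc (Suc k)) z) (at z)"
    by (rule has_field_derivative_transform_within_open[where S = "{z. Im z > 0}"])
       (use Suc in \<open>auto simp: open_halfspace_Im_gt\<close>)
  moreover have "(?F has_field_derivative
      - ((2 * of_real pi * \<i>) ^ (k+2)) * (2 * of_real pi * \<i> * npow_series (Suc (Suc k)) z)) (at z)"
    using Suc.prems by (intro DERIV_cmult has_field_derivative_npow_series)
  ultimately have "(-1) ^ Suc k * (- Polygamma (Suc (Suc k)) (1 - z)) - Polygamma (Suc (Suc k)) z =
      - ((2 * of_real pi * \<i>) ^ (k+2)) * (2 * of_real pi * \<i> * npow_series (Suc (Suc k)) z)"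
    by (rule DERIV_unique)
  then show ?case by (simp add: mult_ac)
qed

definition Lipschitz_const :: "nat \<Rightarrow> complex" where
  "Lipschitz_const k = (- 2 * of_real pi * \<i>) ^ Suc k / fact k"

text \<open>
  A Polygamma value at z is the sum over z, z + 1, z + 2, ..., and the one at 1 - z is, up to
  sign, the sum over z - 1, z - 2, ...; together they give the sum over all translates of z.
\<close>

theorem Lipschitz:
  assumes z: "Im z > 0" and k: "k \<ge> 1"
  shows "((\<lambda>n::int. 1 / (z + of_int n) ^ Suc k) has_sum (Lipschitz_const k * npow_series k z)) UNIV"
proof -
  obtain k' where k': "k = Suc k'" using k by (cases k) auto
  let ?f = "\<lambda>n::int. 1 / (z + of_int n) ^ Suc k"
  have abs: "(\<lambda>n. norm (?f n)) summable_on UNIV"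
    using summable_int_translates[OF z, of "Suc k"] k by (simp add: norm_divide norm_power del: power_Suc)
  have nz: "z \<noteq> 0" "1 - z \<noteq> 0" using z by auto
  have "(\<lambda>n. ?f (int n)) sums ((-1) ^ Suc k * Polygamma k z / fact k)"
    using Polygamma_LIMSEQ[OF nz(1), of k] k by (simp add: inverse_eq_divide del: power_Suc)
  moreover have "(\<lambda>n. ?f (int n)) summable_on UNIV"
    using summable_on_reindex[of int UNIV ?f] summable_on_subset_banach[OF abs_summable_summable[OF abs], of "range int"]
    by (simp add: o_def del: power_Suc)
  ultimately have 1: "((\<lambda>n. ?f (int n)) has_sum ((-1) ^ Suc k * Polygamma k z / fact k)) UNIV"
    by (metis has_sum_imp_sums has_sum_infsum sums_unique2)
  have "(\<lambda>n. (-1) ^ Suc k * inverse ((1 - z + of_nat n) ^ Suc k)) sums ((-1) ^ Suc k * ((-1) ^ Suc k * Polygamma k (1 - z) / fact k))"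
    using Polygamma_LIMSEQ[OF nz(2), of k] k by (intro sums_mult) simp
  also have "(\<lambda>n. (-1) ^ Suc k * inverse ((1 - z + of_nat n) ^ Suc k)) = (\<lambda>n. ?f (- int (Suc n)))"
  proof
    fix n
    have *: "z + of_int (- int (Suc n)) = (-1) * (1 - z + of_nat n)" by simp
    have "1 / ((-1) ^ Suc k * x) = (-1) ^ Suc k * inverse x" for x :: complex
      by (cases "even k") (auto simp: field_simps)
    then show "(-1) ^ Suc k * inverse ((1 - z + of_nat n) ^ Suc k) = ?f (- int (Suc n))"
      unfolding * power_mult_distrib by metis
  qed
  also have "(-1) ^ Suc k * ((-1) ^ Suc k * Polygamma k (1 - z) / fact k) = Polygamma k (1 - z) / fact k"
    by (simp flip: power_add mult.assoc)
  finally have "(\<lambda>n. ?f (- int (Suc n))) sums (Polygamma k (1 - z) / fact k)" .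
  moreover have "(\<lambda>n. ?f (- int (Suc n))) summable_on UNIV"
    using summable_on_reindex[of "\<lambda>n. - int (Suc n)" UNIV ?f] summable_on_subset_banach[OF abs_summable_summable[OF abs], of "range (\<lambda>n. - int (Suc n))"]
    by (simp add: o_def inj_on_def del: power_Suc)
  ultimately have 2: "((\<lambda>n. ?f (- int (Suc n))) has_sum (Polygamma k (1 - z) / fact k)) UNIV"
    by (metis has_sum_imp_sums has_sum_infsum sums_unique2)
  have "(-1) ^ Suc k * Polygamma k z / fact k + Polygamma k (1 - z) / fact k =
        (-1) ^ k * ((-1) ^ k * Polygamma k (1 - z) - Polygamma k z) / fact k"
    by (simp add: algebra_simps add_divide_distrib diff_divide_distrib flip: power_add power_mult_distrib)
  also have "(-1) ^ k * Polygamma k (1 - z) - Polygamma k z = - ((2 * of_real pi * \<i>) ^ Suc k) * npow_series k z"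
    using Polygamma_reflection[OF z, of k'] k' by simp
  also have "(-1) ^ k * (- ((2 * of_real pi * \<i>) ^ Suc k) * npow_series k z) / fact k = Lipschitz_const k * npow_series k z"
  proof -
    have "(- 2 * of_real pi * \<i>) ^ Suc k = (-1) ^ Suc k * (2 * of_real pi * \<i>) ^ Suc k"
      by (metis (no_types, lifting) mult_minus_left power_minus)
    then show ?thesis by (simp add: Lipschitz_const_def)
  qed
  finally show ?thesis using int_sum_split[OF 1 2] by simp
qed

section \<open>The transformation of the Eisenstein series of weight 2\<close>

lemma Im_S_pos: "Im z > 0 \<Longrightarrow> Im (- 1 / z) > 0"
  using Im_moebius_pos(3)[of z 0 0 "-1" 1] by simp

text \<open>
  The half-open symmetric intervals are the ones over which sums of the form g(d) - g(d + 1)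
  telescope.
\<close>

lemma int_partial_sums:
  fixes f :: "int \<Rightarrow> 'a :: {comm_monoid_add, topological_space}"
  assumes "(f has_sum S) UNIV"
  shows "(\<lambda>N. sum f {- int N..<int N}) \<longlonglongrightarrow> S"
proof -
  have "filterlim (\<lambda>N. {- int N..<int N}) (finite_subsets_at_top UNIV) sequentially"
    unfolding filterlim_finite_subsets_at_top
  proof (intro allI impI)
    fix X :: "int set" assume X: "finite X \<and> X \<subseteq> UNIV"
    obtain B where B: "\<And>x. x \<in> X \<Longrightarrow> \<bar>x\<bar> \<le> B"
      using X finite_imageI[of X abs] by (meson Max_ge imageI)
    show "eventually (\<lambda>N. finite {- int N..<int N} \<and> X \<subseteq> {- int N..<int N} \<and> {- int N..<int N} \<subseteq> UNIV) sequentially"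
      using eventually_ge_at_top[of "nat (B + 1)"] by eventually_elim (use B in fastforce)
  qed
  with assms show ?thesis unfolding has_sum_def using filterlim_compose by blast
qed

lemma has_sum_nonzero_ints:
  fixes g :: "nat \<Rightarrow> 'a :: {topological_comm_monoid_add, t2_space}"
  assumes "(g has_sum S) {1..}"
  shows "((\<lambda>c::int. g (nat \<bar>c\<bar>)) has_sum (S + S)) (- {0})"
proof -
  have 1: "((\<lambda>c::int. g (nat \<bar>c\<bar>)) has_sum S) {0<..}"
    by (rule has_sum_reindex_bij_witness[of _ int nat, THEN iffD2, OF _ _ _ _ _ _ assms]) auto
  have 2: "((\<lambda>c::int. g (nat \<bar>c\<bar>)) has_sum S) {..<0}"
    by (rule has_sum_reindex_bij_witness[of _ "\<lambda>n. - int n" "\<lambda>n. nat (- n)", THEN iffD2, OF _ _ _ _ _ _ assms]) auto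
  have "{0<..} \<union> {..<0} = - {0 :: int}" "{0<..} \<inter> {..<0} = ({} :: int set)" by auto
  then show ?thesis using has_sum_Un_disjoint[OF 1 2] by metis
qed

lemma has_sum_drop_0:
  fixes f :: "nat \<Rightarrow> 'a :: {comm_monoid_add, topological_space}"
  assumes "(f has_sum S) UNIV" "f 0 = 0"
  shows "(f has_sum S) {1..}"
proof -
  have "(f has_sum S) UNIV \<longleftrightarrow> (f has_sum S) {1..}"
  proof (rule has_sum_cong_neutral)
    fix x :: nat assume "x \<in> UNIV - {1..}"
    then have "x = 0" by simp
    then show "f x = 0" using assms(2) by simp
  qed auto
  with assms(1) show ?thesis by blast
qed

lemma summable_norm_on_from_1:
  fixes f :: "nat \<Rightarrow> 'a :: real_normed_vector"
  assumes "summable (\<lambda>n. norm (f n))"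
  shows "(\<lambda>n. norm (f n)) summable_on {1..}"
proof -
  have "(\<lambda>n. norm (f n)) summable_on UNIV"
    using assms by (rule summable_nonneg_imp_summable_on) auto
  then show ?thesis by (rule summable_on_subset_banach) auto
qed

lemma has_sum_npow_series:
  assumes "Im z > 0" "k \<ge> 1"
  shows "((\<lambda>n. of_nat n ^ k * qexp z ^ n) has_sum npow_series k z) {1..}"
    "(\<lambda>n. norm (of_nat n ^ k * qexp z ^ n)) summable_on {1..}"
proof -
  have u: "norm (of_real (norm (qexp z)) :: complex) < 1" using norm_qexp_less_1[OF assms(1)] by simp
  have "summable (\<lambda>n. of_nat n ^ k * of_real (norm (qexp z)) ^ n :: complex)"
    by (rule summable_npower[OF u])
  then have "summable (\<lambda>n. of_real (of_nat n ^ k * norm (qexp z) ^ n) :: complex)"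
    by simp
  then have "summable (\<lambda>n. of_nat n ^ k * norm (qexp z) ^ n)"
    by (simp only: summable_complex_of_real)
  then have s: "summable (\<lambda>n. norm (of_nat n ^ k * qexp z ^ n))"
    by (simp add: norm_mult norm_power)
  have "((\<lambda>n. of_nat n ^ k * qexp z ^ n) has_sum npow_series k z) UNIV"
    unfolding npow_series_def by (rule norm_summable_imp_has_sum[OF s summable_sums[OF summable_norm_cancel[OF s]]])
  then show "((\<lambda>n. of_nat n ^ k * qexp z ^ n) has_sum npow_series k z) {1..}"
    by (rule has_sum_drop_0) (use assms in simp)
  show "(\<lambda>n. norm (of_nat n ^ k * qexp z ^ n)) summable_on {1..}"
    by (rule summable_norm_on_from_1[OF s])
qed

lemma divisor_sigma_0 [simp]: "divisor_sigma 0 = 0"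
  by (simp add: divisor_sigma_def)

lemma divisor_sigma_le: "divisor_sigma n \<le> n ^ 2"
proof (cases "n = 0")
  case False
  have "{d. d dvd n} \<subseteq> {1..n}"
    using False by (auto simp: Suc_le_eq dvd_pos_nat dvd_imp_le)
  then have "divisor_sigma n \<le> (\<Sum>d\<in>{1..n}. d)"
    unfolding divisor_sigma_def by (intro sum_mono2) auto
  also have "\<dots> \<le> (\<Sum>d\<in>{1..n}. n)"
    by (intro sum_mono) auto
  finally have "divisor_sigma n \<le> (\<Sum>d\<in>{1..n}. n)" .
  then show ?thesis by (simp add: power2_eq_square)
qed simp

lemma summable_sigma:
  fixes u :: complex
  assumes "norm u < 1"
  shows "summable (\<lambda>n. norm (of_nat (divisor_sigma n) * u ^ n))"
proof (rule summable_comparison_test')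
  have u: "norm (of_real (norm u) :: complex) < 1" using assms by simp
  have "summable (\<lambda>n. of_nat n ^ 2 * of_real (norm u) ^ n :: complex)"
    by (rule summable_npower[OF u])
  then have "summable (\<lambda>n. of_real (of_nat n ^ 2 * norm u ^ n) :: complex)"
    by simp
  then show "summable (\<lambda>n. of_nat n ^ 2 * norm u ^ n)"
    by (simp only: summable_complex_of_real)
  fix n :: nat
  have "real (divisor_sigma n) \<le> real n ^ 2" 
    using divisor_sigma_le[of n] by (metis of_nat_le_iff of_nat_power)
  then show "norm (norm (of_nat (divisor_sigma n) * u ^ n)) \<le> of_nat n ^ 2 * norm u ^ n"
    by (simp add: norm_mult norm_power mult_right_mono)
qed

definition sigma_series :: "complex \<Rightarrow> complex" where
  "sigma_series z = (\<Sum>n. of_nat (divisor_sigma n) * qexp z ^ n)"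

lemma has_sum_sigma_series:
  assumes "Im z > 0"
  shows "((\<lambda>n. of_nat (divisor_sigma n) * qexp z ^ n) has_sum sigma_series z) {1..}"
proof -
  have s: "summable (\<lambda>n. norm (of_nat (divisor_sigma n) * qexp z ^ n))"
    by (rule summable_sigma[OF norm_qexp_less_1[OF assms]])
  have "((\<lambda>n. of_nat (divisor_sigma n) * qexp z ^ n) has_sum sigma_series z) UNIV"
    unfolding sigma_series_def by (rule norm_summable_imp_has_sum[OF s summable_sums[OF summable_norm_cancel[OF s]]])
  then show ?thesis
    by (rule has_sum_drop_0) simp
qed

text \<open>
  Both sides are rearrangements of the absolutely convergent double series \<Sum> N q^(c N), grouped
  by c on the left and by the product n = c N on the right.
\<close>

theorem Lambert_series_sigma:
  assumes z: "Im z > 0"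
  shows "((\<lambda>c. npow_series 1 (of_nat c * z)) has_sum sigma_series z) {1..}"
proof -
  let ?q = "qexp z"
  define S where "S = (SIGMA n:{1::nat..}. {d. d dvd n})"
  have inner: "((\<lambda>d. norm (of_nat d * ?q ^ n)) has_sum norm (of_nat (divisor_sigma n) * ?q ^ n)) {d. d dvd n}" if "n \<ge> 1" for n
    using that by (subst has_sum_finite_iff)
      (auto simp: divisor_sigma_def norm_mult sum_distrib_right[symmetric] simp flip: of_nat_sum)
  have sm: "(\<lambda>(n,d). norm (of_nat d * ?q ^ n)) summable_on S"
    unfolding S_def
  proof (rule summable_on_SigmaI)
    show "(\<lambda>n. norm (of_nat (divisor_sigma n) * ?q ^ n)) summable_on {1..}"
      by (rule summable_norm_on_from_1[OF summable_sigma[OF norm_qexp_less_1[OF z]]])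
  qed (use inner in auto)
  then have "(\<lambda>(n,d). of_nat d * ?q ^ n) summable_on S"
    using abs_summable_summable[of "\<lambda>(n,d). of_nat d * ?q ^ n" S] by (simp add: case_prod_unfold)
  then obtain T where T: "((\<lambda>(n,d). of_nat d * ?q ^ n) has_sum T) S"
    using has_sum_infsum by blast
  have "((\<lambda>n. of_nat (divisor_sigma n) * ?q ^ n) has_sum T) {1..}"
  proof (rule has_sum_SigmaD[OF T[unfolded S_def]])
    fix n :: nat assume "n \<in> {1..}"
    then show "((\<lambda>d. case (n, d) of (n, d) \<Rightarrow> of_nat d * ?q ^ n) has_sum of_nat (divisor_sigma n) * ?q ^ n) {d. d dvd n}"
      by (subst has_sum_finite_iff) (auto simp: divisor_sigma_def sum_distrib_right[symmetric])
  qed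
  with has_sum_sigma_series[OF z] have T_eq: "T = sigma_series z" using has_sum_unique by blast
  have "((\<lambda>(c,N). of_nat N * ?q ^ (c * N)) has_sum T) ({1..} \<times> {1..})"
  proof (rule has_sum_reindex_bij_witness[of _ "\<lambda>(n,d). (n div d, d)" "\<lambda>(c,N). (c * N, N)", THEN iffD2, OF _ _ _ _ _ _ T], goal_cases)
    case (4 b)
    then obtain n d where b: "b = (n,d)" "n \<ge> 1" "d dvd n" by (auto simp: S_def)
    then obtain k where "n = d * k" by blast
    with b show ?case by simp
  qed (auto simp: S_def)
  then show ?thesis unfolding T_eq[symmetric]
  proof (rule has_sum_SigmaD)
    fix c :: nat assume c: "c \<in> {1..}"
    have "((\<lambda>n. of_nat n ^ 1 * qexp (of_nat c * z) ^ n) has_sum npow_series 1 (of_nat c * z)) {1..}"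
      by (rule has_sum_npow_series) (use c z in auto)
    then show "((\<lambda>N. case (c, N) of (c, N) \<Rightarrow> of_nat N * ?q ^ (c * N)) has_sum npow_series 1 (of_nat c * z)) {1..}"
      by (simp add: qexp_power[symmetric] power_mult)
  qed
qed

lemma Lipschitz_2:
  fixes c :: int
  assumes z: "Im z > 0" and c: "c \<noteq> 0"
  shows "((\<lambda>d::int. 1 / (of_int c * z + of_int d)\<^sup>2) has_sum (Lipschitz_const 1 * npow_series 1 (of_nat (nat \<bar>c\<bar>) * z))) UNIV"
proof (cases "c > 0")
  case True
  then have "of_int c = (of_nat (nat \<bar>c\<bar>) :: complex)" by simp
  moreover have "Im (of_nat (nat \<bar>c\<bar>) * z) > 0" using True z by simp
  ultimately show ?thesis using Lipschitz[of "of_nat (nat \<bar>c\<bar>) * z" 1]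
    by (simp add: numeral_2_eq_2)
next
  case False
  then have *: "of_int c = - (of_nat (nat \<bar>c\<bar>) :: complex)" by simp
  have "Im (of_nat (nat \<bar>c\<bar>) * z) > 0" using False c z by (simp add: mult_less_0_iff)
  then have "((\<lambda>d::int. 1 / (of_nat (nat \<bar>c\<bar>) * z + of_int d)\<^sup>2) has_sum (Lipschitz_const 1 * npow_series 1 (of_nat (nat \<bar>c\<bar>) * z))) UNIV"
    using Lipschitz[of "of_nat (nat \<bar>c\<bar>) * z" 1] by (simp add: numeral_2_eq_2)
  note L = this
  show ?thesis
  proof (rule has_sum_reindex_bij_witness[of _ uminus uminus, THEN iffD2, OF _ _ _ _ _ _ L], goal_cases)
    case (5 d)
    have "of_nat (nat \<bar>c\<bar>) * z + of_int (- d) = - (of_int c * z + of_int d)" by (simp add: *)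
    then show ?case by (simp only: power2_minus)
  qed auto
qed

lemma sum_int_telescope:
  fixes g :: "int \<Rightarrow> 'a :: ab_group_add"
  shows "(\<Sum>d\<in>{- int N..<int N}. g d - g (d + 1)) = g (- int N) - g (int N)"
proof (induction N)
  case (Suc N)
  have "{- int (Suc N)..<int (Suc N)} = insert (- int (Suc N)) (insert (int N) {- int N..<int N})" by auto
  then show ?case using Suc by (simp add: algebra_simps)
qed simp

text \<open>
  The partial fractions of the cotangent at t, with the pole at 0 removed, in the form in which the
  Digamma function provides them.
\<close>

lemma cot_pole_sum:
  assumes t: "Im t > 0"
  shows "(\<lambda>n. 1 / (of_nat (Suc n) + t) - 1 / (of_nat (Suc n) - t)) sums
           (of_real pi * \<i> - 2 * of_real pi * \<i> * npow_series 0 t - 1 / t)"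
proof -
  have nz: "1 - t \<noteq> 0" "1 + t \<noteq> 0" "t \<noteq> 0"
    using t by (auto simp: complex_eq_iff)
  have "(\<lambda>n. inverse (of_nat (Suc n)) - inverse (x + of_nat n)) sums (Digamma x + euler_mascheroni)"
    if "x \<noteq> 0" for x :: complex
    using summable_sums[OF summable_Digamma[OF that]] by (simp only: Digamma_def diff_add_cancel)
  then have "(\<lambda>n. (inverse (of_nat (Suc n)) - inverse (1 - t + of_nat n)) - (inverse (of_nat (Suc n)) - inverse (1 + t + of_nat n)))
      sums ((Digamma (1 - t) + euler_mascheroni) - (Digamma (1 + t) + euler_mascheroni))"
    by (intro sums_diff) (use nz in blast)+
  also have "(Digamma (1 - t) + euler_mascheroni) - (Digamma (1 + t) + euler_mascheroni) = Digamma (1 - t) - Digamma t - 1 / t"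
    using Polygamma_plus1[OF nz(3), of 0] by (simp add: add_ac)
  also have "\<dots> = of_real pi * \<i> - 2 * of_real pi * \<i> * npow_series 0 t - 1 / t"
    using Digamma_reflection[OF t] by simp
  finally show ?thesis by (simp add: inverse_eq_divide algebra_simps)
qed

lemma npow_series_0: "Im z > 0 \<Longrightarrow> npow_series 0 z = 1 / (1 - qexp z)"
  using norm_qexp_less_1 by (simp add: npow_series_def suminf_geometric)

lemma has_sum_sum:
  fixes f :: "'i \<Rightarrow> 'a \<Rightarrow> 'b :: topological_comm_monoid_add"
  assumes "finite I" "\<And>i. i \<in> I \<Longrightarrow> (f i has_sum S i) A"
  shows "((\<lambda>x. \<Sum>i\<in>I. f i x) has_sum (\<Sum>i\<in>I. S i)) A"
  using assms by (induction I rule: finite_induct) (auto intro!: has_sum_add)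

text \<open>
  This is the boundary term that measures the failure of the two orders of summation in the
  Eisenstein series of weight 2 to agree.
\<close>

lemma cot_lattice_sum:
  assumes z: "Im z > 0" and N: "N \<ge> 1"
    and W: "((\<lambda>c::int. 1 / (of_int c * z - of_nat N) - 1 / (of_int c * z + of_nat N)) has_sum W) (- {0})"
  shows "W = 2 / z * (of_real pi * \<i> - 2 * of_real pi * \<i> * npow_series 0 (of_nat N * (- 1 / z)) + z / of_nat N)"
proof -
  define t where "t = of_nat N * (- 1 / z)"
  have z0: "z \<noteq> 0" using z by auto
  have t: "Im t > 0" 
  proof -
    have "Im t = of_nat N * Im (- 1 / z)" unfolding t_def times_complex.simps by simp
    then show ?thesis using mult_pos_pos[OF _ Im_S_pos[OF z], of "of_nat N"] N by simp
  qed
  define g where "g = (\<lambda>n::nat. 1 / (of_nat n * z - of_nat N) - 1 / (of_nat n * z + of_nat N))"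
  let ?v = "\<lambda>c::int. 1 / (of_int c * z - of_nat N) - 1 / (of_int c * z + of_nat N)"
  have even: "?v c = g (nat \<bar>c\<bar>)" for c
  proof (cases "c \<ge> 0")
    case False
    have "of_int c = - (of_nat (nat \<bar>c\<bar>) :: complex)" using False by simp
    then have *: "of_int c * z - of_nat N = - (of_nat (nat \<bar>c\<bar>) * z + of_nat N)" 
      "of_int c * z + of_nat N = - (of_nat (nat \<bar>c\<bar>) * z - of_nat N)" by simp_all
    show ?thesis unfolding g_def *
      by (simp only: minus_divide_right[symmetric] diff_minus_eq_add uminus_add_conv_diff)
  qed (simp add: g_def)
  have "g summable_on {1..}"
  proof -
    have "?v summable_on {0<..}"
      using has_sum_imp_summable[OF W] by (rule summable_on_subset_banach) auto
    moreover have "?v summable_on {0<..} \<longleftrightarrow> g summable_on {1..}"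
      by (rule summable_on_reindex_bij_witness[of _ int nat]) (auto simp: even)
    ultimately show ?thesis by simp
  qed
  then obtain Y where Y: "(g has_sum Y) {1..}" by (auto simp: summable_on_def)
  have "(?v has_sum (Y + Y)) (- {0})" using has_sum_nonzero_ints[OF Y] by (simp only: even)
  with W have WY: "W = Y + Y" using has_sum_unique by blast
  have "((\<lambda>n. g (Suc n)) has_sum Y) UNIV"
    by (rule has_sum_reindex_bij_witness[of _ "\<lambda>n. n - 1" Suc, THEN iffD2, OF _ _ _ _ _ _ Y]) auto
  then have "(\<lambda>n. g (Suc n)) sums Y" by (rule has_sum_imp_sums)
  moreover have "(\<lambda>n. g (Suc n)) sums (1 / z * (of_real pi * \<i> - 2 * of_real pi * \<i> * npow_series 0 t - 1 / t))"
  proof -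
    have "of_nat (Suc n) * z - of_nat N = z * (of_nat (Suc n) + t)" "of_nat (Suc n) * z + of_nat N = z * (of_nat (Suc n) - t)" for n
      using z0 by (simp_all add: t_def algebra_simps del: of_nat_Suc)
    then have "g (Suc n) = 1 / z * (1 / (of_nat (Suc n) + t) - 1 / (of_nat (Suc n) - t))" for n
      unfolding g_def by (simp add: diff_divide_distrib right_diff_distrib del: of_nat_Suc)
    then show ?thesis using sums_mult[OF cot_pole_sum[OF t], of "1 / z"] by simp
  qed
  ultimately have "Y = 1 / z * (of_real pi * \<i> - 2 * of_real pi * \<i> * npow_series 0 t - 1 / t)"
    using sums_unique2 by blast
  moreover have "x + x = 2 / z * y" if "x = 1 / z * y" for x y
    using that by simp
  ultimately have "W = 2 / z * (of_real pi * \<i> - 2 * of_real pi * \<i> * npow_series 0 t - 1 / t)"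
    unfolding WY by blast
  then show ?thesis by (simp add: t_def)
qed

definition E2 :: "complex \<Rightarrow> complex" where
  "E2 z = 1 - 24 * sigma_series z"

lemma tendsto_inverse_shift:
  "(\<lambda>N. 1 / (w + of_nat N :: complex)) \<longlonglongrightarrow> 0" "(\<lambda>N. 1 / (w - of_nat N :: complex)) \<longlonglongrightarrow> 0"
proof -
  show 1: "(\<lambda>N. 1 / (w + of_nat N :: complex)) \<longlonglongrightarrow> 0" for w
    by (intro tendsto_divide_0[OF tendsto_const] tendsto_add_filterlim_at_infinity[OF tendsto_const] tendsto_of_nat)
  have *: "w - of_nat N = - (- w + of_nat N)" for N :: nat by simp
  show "(\<lambda>N. 1 / (w - of_nat N :: complex)) \<longlonglongrightarrow> 0"
    unfolding * using tendsto_minus[OF 1[of "- w"]] by (simp only: minus_divide_right minus_zero)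
qed

lemma Lipschitz_const_1: "Lipschitz_const 1 = - 4 * of_real pi ^ 2"
  by (simp add: Lipschitz_const_def power2_eq_square)

lemma has_sum_inverse_squares_real: "((\<lambda>n::nat. 1 / real n ^ 2) has_sum (pi ^ 2 / 6)) {1..}"
proof -
  have s: "summable (\<lambda>n. norm (1 / real (Suc n) ^ 2))" "(\<lambda>n. 1 / real (Suc n) ^ 2) sums (pi ^ 2 / 6)"
    using inverse_squares_sums by (auto simp: sums_iff add_ac)
  have X: "((\<lambda>n. 1 / real (Suc n) ^ 2) has_sum (pi ^ 2 / 6)) UNIV"
    by (rule norm_summable_imp_has_sum[OF s])
  show ?thesis
    by (rule has_sum_reindex_bij_witness[of _ Suc "\<lambda>n. n - 1", THEN iffD2, OF _ _ _ _ _ _ X]) auto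
qed

lemma has_sum_inverse_squares: "((\<lambda>n::nat. 1 / of_nat n ^ 2 :: complex) has_sum (of_real pi ^ 2 / 6)) {1..}"
  using has_sum_of_real[OF has_sum_inverse_squares_real, where ?'a = complex] by simp

lemma of_nat_nat_abs_square: "(of_nat (nat \<bar>c\<bar>) :: complex) ^ 2 = of_int c ^ 2"
  by (cases "c \<ge> 0") auto

text \<open>
  The Eisenstein series \<Sum> (c z + d)^(-2) converges only conditionally: summing over d first gives
  E_2(z), summing over c first gives z^(-2) E_2(-1/z), up to the common factor and the terms with
  c = 0 or d = 0.  Subtracting 1/(c z + d) - 1/(c z + d + 1) makes the double series absolutely
  convergent.  Over d these corrections telescope to 0; over c first and then over -N \<le> d < N they
  sum to a difference of cotangents, whose limit supplies the term linear in z.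
\<close>

theorem E2_S:
  assumes z: "Im z > 0"
  shows "E2 (- 1 / z) = z ^ 2 * E2 z + 6 * z / (of_real pi * \<i>)"
proof -
  define z' where "z' = - 1 / z"
  have z0: "z \<noteq> 0" using z by auto
  have z': "Im z' > 0" unfolding z'_def using z by (rule Im_S_pos)
  define f where "f = (\<lambda>(c::int,d::int). 1 / ((of_int c * z + of_int d) ^ 2 * (of_int c * z + of_int (d + 1))))"
  define v where "v = (\<lambda>c d::int. 1 / (of_int c * z + of_int d) - 1 / (of_int c * z + of_int (d + 1)))"
  have fv: "f (c,d) = 1 / (of_int c * z + of_int d) ^ 2 - v c d" if "c \<noteq> 0" for c d
  proof -
    have "of_int c * z + of_int d \<noteq> 0" "of_int c * z + of_int (d + 1) \<noteq> 0"
      using lattice_form_nonzero[OF z] that by blast+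
    then show ?thesis by (simp add: f_def v_def divide_simps power2_eq_square)
  qed
  have abs: "(\<lambda>p. norm (f p)) summable_on (- {0}) \<times> UNIV"
  proof -
    have s1: "(\<lambda>(c,d). 1 / norm (of_int c * z + of_int d) ^ 3) summable_on (UNIV :: (int \<times> int) set)"
      by (rule summable_lattice[OF z]) simp
    moreover have "(\<lambda>(c,d). 1 / norm (of_int c * z + of_int (d + 1)) ^ 3) summable_on (UNIV :: (int \<times> int) set)"
      by (rule summable_on_reindex_bij_witness[of _ "\<lambda>(c,d). (c, d - 1)" "\<lambda>(c,d). (c, d + 1)", THEN iffD2, OF _ _ _ _ _ s1]) auto
    ultimately have "(\<lambda>x. (case x of (c,d) \<Rightarrow> 1 / norm (of_int c * z + of_int d) ^ 3) + 
          (case x of (c,d) \<Rightarrow> 1 / norm (of_int c * z + of_int (d + 1)) ^ 3)) summable_on (UNIV :: (int \<times> int) set)"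
      by (rule summable_on_add)
    then have "(\<lambda>x. (case x of (c,d) \<Rightarrow> 1 / norm (of_int c * z + of_int d) ^ 3) + 
          (case x of (c,d) \<Rightarrow> 1 / norm (of_int c * z + of_int (d + 1)) ^ 3)) summable_on ((- {0}) \<times> UNIV :: (int \<times> int) set)"
      by (rule summable_on_subset_banach) auto
    then show ?thesis
    proof (rule summable_on_comparison_test, goal_cases)
      case (1 p)
      obtain c d where p: "p = (c,d)" by force
      define x y where "x = norm (of_int c * z + of_int d)" and "y = norm (of_int c * z + of_int (d + 1))"
      have pos: "x > 0" "y > 0" using lattice_form_nonzero[OF z] 1 p by (auto simp: x_def y_def simp del: of_int_add)
      have "1 / (x ^ 2 * y) \<le> 1 / x ^ 3 + 1 / y ^ 3"
      proof (cases "x \<le> y")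
        case True
        have "x ^ 3 \<le> x ^ 2 * y" using True pos by (simp add: power2_eq_square power3_eq_cube)
        then have "1 / (x ^ 2 * y) \<le> 1 / x ^ 3" using pos by (intro divide_left_mono) auto
        moreover have "0 \<le> 1 / y ^ 3" using pos by simp
        ultimately show ?thesis by linarith
      next
        case False
        have "y ^ 3 \<le> x ^ 2 * y" using False pos by (simp add: power2_eq_square power3_eq_cube mult_mono)
        then have "1 / (x ^ 2 * y) \<le> 1 / y ^ 3" using pos by (intro divide_left_mono) auto
        moreover have "0 \<le> 1 / x ^ 3" using pos by simp
        ultimately show ?thesis by linarith
      qed
      then show ?case by (simp add: p f_def x_def y_def norm_divide norm_mult norm_power)
    qed auto
  qed
  then obtain B where B: "(f has_sum B) ((- {0}) \<times> UNIV)"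
    using abs_summable_summable[OF abs] by (auto simp: summable_on_def)
  define L where "L = (\<lambda>z c. Lipschitz_const 1 * npow_series 1 (of_nat c * z))"
  have Lsum: "((\<lambda>c::int. L z (nat \<bar>c\<bar>)) has_sum (2 * Lipschitz_const 1 * sigma_series z)) (- {0})" if "Im z > 0" for z
  proof -
    have "(L z has_sum (Lipschitz_const 1 * sigma_series z)) {1..}"
      unfolding L_def using Lambert_series_sigma[OF that] by (rule has_sum_cmult_right)
    from has_sum_nonzero_ints[OF this] show ?thesis by (simp add: mult.assoc flip: mult_2)
  qed
  have row: "((\<lambda>d. f (c,d)) has_sum L z (nat \<bar>c\<bar>)) UNIV" if c: "c \<in> - {0}" for c
  proof -
    have c0: "c \<noteq> 0" using c by simp
    have 1: "((\<lambda>d. 1 / (of_int c * z + of_int d) ^ 2) has_sum L z (nat \<bar>c\<bar>)) UNIV"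
      unfolding L_def by (rule Lipschitz_2[OF z c0])
    have abs1: "(\<lambda>d. norm (f (c,d))) summable_on UNIV"
      using abs c unfolding Infinite_Sum.abs_summable_on_Sigma_iff by blast
    obtain T where T: "((\<lambda>d. f (c,d)) has_sum T) UNIV"
      using abs_summable_summable[OF abs1] by (auto simp: summable_on_def)
    have "((\<lambda>d. 1 / (of_int c * z + of_int d) ^ 2 + - f (c,d)) has_sum (L z (nat \<bar>c\<bar>) + - T)) UNIV"
      by (intro has_sum_add 1 has_sum_uminusI T)
    then have "(v c has_sum (L z (nat \<bar>c\<bar>) - T)) UNIV"
      using fv[OF c0] by simp
    from int_partial_sums[OF this]
    have "(\<lambda>N. 1 / (of_int c * z + of_int (- int N)) - 1 / (of_int c * z + of_int (int N))) \<longlonglongrightarrow> L z (nat \<bar>c\<bar>) - T"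
      unfolding v_def sum_int_telescope[of "\<lambda>d. 1 / (of_int c * z + of_int d)"] .
    moreover have "(\<lambda>N. 1 / (of_int c * z + of_int (- int N)) - 1 / (of_int c * z + of_int (int N))) \<longlonglongrightarrow> 0 - 0"
      using tendsto_diff[OF tendsto_inverse_shift(2)[of "of_int c * z"] tendsto_inverse_shift(1)[of "of_int c * z"]] by simp
    ultimately have "L z (nat \<bar>c\<bar>) - T = 0 - 0" by (rule LIMSEQ_unique)
    with T show ?thesis by simp
  qed
  have B_eq: "B = 2 * Lipschitz_const 1 * sigma_series z"
    using has_sum_unique[OF has_sum_SigmaD[OF B row] Lsum[OF z]] by simp
  \<comment> \<open>Lipschitz at -d/z includes the term c = 0, which is removed again by subtracting 1 / d^2.\<close>
  define R where "R = (\<lambda>d::int. if d = 0 then z' ^ 2 * (of_real pi ^ 2 / 3) else z' ^ 2 * L z' (nat \<bar>d\<bar>) - 1 / of_nat (nat \<bar>d\<bar>) ^ 2)"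
  have r: "((\<lambda>c::int. 1 / (of_int c * z + of_int d) ^ 2) has_sum R d) (- {0})" for d :: int
  proof (cases "d = 0")
    case True
    have "((\<lambda>c::int. 1 / of_nat (nat \<bar>c\<bar>) ^ 2) has_sum (of_real pi ^ 2 / 6 + of_real pi ^ 2 / 6 :: complex)) (- {0})"
      by (rule has_sum_nonzero_ints[OF has_sum_inverse_squares])
    then have "((\<lambda>c::int. z' ^ 2 * (1 / of_nat (nat \<bar>c\<bar>) ^ 2)) has_sum (z' ^ 2 * (of_real pi ^ 2 / 6 + of_real pi ^ 2 / 6) :: complex)) (- {0})"
      by (rule has_sum_cmult_right)
    moreover have "z' ^ 2 * (1 / of_nat (nat \<bar>c\<bar>) ^ 2) = 1 / (of_int c * z + of_int d) ^ 2" for c :: int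
    proof -
      have "(of_nat (nat \<bar>c\<bar>) :: complex) ^ 2 = of_int c ^ 2"
        by (rule of_nat_nat_abs_square)
      then show ?thesis by (simp add: True z'_def power_divide power_mult_distrib)
    qed
    moreover have "z' ^ 2 * (of_real pi ^ 2 / 6 + of_real pi ^ 2 / 6) = R d" by (simp add: R_def True)
    ultimately show ?thesis by simp
  next
    case False
    have X: "((\<lambda>c::int. 1 / (of_int d * z' + of_int c)\<^sup>2) has_sum L z' (nat \<bar>d\<bar>)) UNIV"
      unfolding L_def by (rule Lipschitz_2[OF z' False])
    have "((\<lambda>c::int. 1 / (of_int d * z' - of_int c)\<^sup>2) has_sum L z' (nat \<bar>d\<bar>)) UNIV"
      by (rule has_sum_reindex_bij_witness[of _ uminus uminus, THEN iffD2, OF _ _ _ _ _ _ X]) auto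
    then have "((\<lambda>c::int. z' ^ 2 * (1 / (of_int d * z' - of_int c)\<^sup>2)) has_sum z' ^ 2 * L z' (nat \<bar>d\<bar>)) UNIV"
      by (rule has_sum_cmult_right)
    moreover have "z' ^ 2 * (1 / (of_int d * z' - of_int c)\<^sup>2) = 1 / (of_int c * z + of_int d) ^ 2" for c :: int
    proof -
      have "of_int d * z' - of_int c = z' * (of_int c * z + of_int d)" using z0 by (simp add: z'_def field_simps)
      moreover have "z' \<noteq> 0" using z0 by (simp add: z'_def)
      ultimately show ?thesis by (simp only: power_mult_distrib) simp
    qed
    ultimately have "((\<lambda>c::int. 1 / (of_int c * z + of_int d) ^ 2) has_sum z' ^ 2 * L z' (nat \<bar>d\<bar>)) UNIV" by simp
    moreover have "((\<lambda>c::int. 1 / (of_int c * z + of_int d) ^ 2) has_sum 1 / of_int d ^ 2) {0}"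
      by (rule has_sum_finiteI) auto
    ultimately
    have "((\<lambda>c::int. 1 / (of_int c * z + of_int d) ^ 2) has_sum z' ^ 2 * L z' (nat \<bar>d\<bar>) - 1 / of_int d ^ 2) (UNIV - {0})"
      by (rule has_sum_Diff) simp
    moreover have "(of_nat (nat \<bar>d\<bar>) :: complex) ^ 2 = of_int d ^ 2"
      by (rule of_nat_nat_abs_square)
    ultimately show ?thesis using False by (simp add: R_def Compl_eq_Diff_UNIV)
  qed
  have Rsum: "(R has_sum (z' ^ 2 * (2 * Lipschitz_const 1 * sigma_series z') - of_real pi ^ 2 / 3 + z' ^ 2 * (of_real pi ^ 2 / 3))) UNIV"
  proof -
    have "((\<lambda>d::int. z' ^ 2 * L z' (nat \<bar>d\<bar>) + - (1 / of_nat (nat \<bar>d\<bar>) ^ 2)) has_sum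
            (z' ^ 2 * (2 * Lipschitz_const 1 * sigma_series z') + - (of_real pi ^ 2 / 6 + of_real pi ^ 2 / 6))) (- {0})"
      by (intro has_sum_add has_sum_cmult_right Lsum[OF z'] has_sum_uminusI has_sum_nonzero_ints[OF has_sum_inverse_squares])
    then have "(R has_sum (z' ^ 2 * (2 * Lipschitz_const 1 * sigma_series z') + - (of_real pi ^ 2 / 6 + of_real pi ^ 2 / 6))) (- {0})"
      by (rule has_sum_cong[THEN iffD1, rotated]) (simp add: R_def)
    moreover have "(R has_sum R 0) {0}"
      by (rule has_sum_finiteI) auto
    ultimately have "(R has_sum (z' ^ 2 * (2 * Lipschitz_const 1 * sigma_series z') + - (of_real pi ^ 2 / 6 + of_real pi ^ 2 / 6) + R 0)) ((- {0}) \<union> {0})"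
      by (rule has_sum_Un_disjoint) auto
    moreover have "(- {0}) \<union> {0} = (UNIV :: int set)" by auto
    ultimately have "(R has_sum (z' ^ 2 * (2 * Lipschitz_const 1 * sigma_series z') + - (of_real pi ^ 2 / 6 + of_real pi ^ 2 / 6) + R 0)) UNIV"
      by simp
    moreover have "z' ^ 2 * (2 * Lipschitz_const 1 * sigma_series z') + - (of_real pi ^ 2 / 6 + of_real pi ^ 2 / 6) + R 0 =
       z' ^ 2 * (2 * Lipschitz_const 1 * sigma_series z') - of_real pi ^ 2 / 3 + z' ^ 2 * (of_real pi ^ 2 / 3)"
      by (simp add: R_def)
    ultimately show ?thesis by (simp only:)
  qed
  define h where "h = (\<lambda>d. \<Sum>\<^sub>\<infinity>c\<in>-{0}. f (c,d))"
  have B': "((\<lambda>(d,c). f (c,d)) has_sum B) (UNIV \<times> (- {0}))"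
    using B by (subst (asm) has_sum_swap) (simp add: case_prod_unfold)
  have abs': "(\<lambda>p. norm (case p of (d,c) \<Rightarrow> f (c,d))) summable_on UNIV \<times> (- {0})"
    by (rule summable_on_reindex_bij_witness[of _ "\<lambda>(c,d). (d,c)" "\<lambda>(d,c). (c,d)", THEN iffD2, OF _ _ _ _ _ abs]) auto
  have col: "((\<lambda>c. f (c,d)) has_sum h d) (- {0})" for d
  proof -
    have "(\<lambda>c. norm (f (c,d))) summable_on (- {0})"
      using abs' unfolding Infinite_Sum.abs_summable_on_Sigma_iff by simp
    then show ?thesis unfolding h_def by (rule has_sum_infsum[OF abs_summable_summable])
  qed
  have hB: "(h has_sum B) UNIV"
    by (rule has_sum_SigmaD[OF B']) (use col in simp)
  have vsum: "((\<lambda>c. v c d) has_sum (R d - h d)) (- {0})" for d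
  proof -
    have "((\<lambda>c. 1 / (of_int c * z + of_int d) ^ 2 + - f (c,d)) has_sum (R d + - h d)) (- {0})"
      by (intro has_sum_add r has_sum_uminusI col)
    then have "((\<lambda>c. v c d) has_sum (R d + - h d)) (- {0})"
      by (rule has_sum_cong[THEN iffD1, rotated]) (use fv in simp)
    then show ?thesis by simp
  qed
  define W where "W = (\<lambda>N. \<Sum>d\<in>{- int N..<int N}. R d - h d)"
  have W_eq: "W N = 2 / z * (of_real pi * \<i> - 2 * of_real pi * \<i> * npow_series 0 (of_nat N * (- 1 / z)) + z / of_nat N)" if "N \<ge> 1" for N
  proof (rule cot_lattice_sum[OF z that])
    have "((\<lambda>c. \<Sum>d\<in>{- int N..<int N}. v c d) has_sum W N) (- {0})"
      unfolding W_def by (intro has_sum_sum vsum) auto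
    then show "((\<lambda>c::int. 1 / (of_int c * z - of_nat N) - 1 / (of_int c * z + of_nat N)) has_sum W N) (- {0})"
      unfolding v_def sum_int_telescope[of "\<lambda>d. 1 / (of_int c * z + of_int d)" for c] by simp
  qed
  have "W \<longlonglongrightarrow> 2 / z * (of_real pi * \<i> - 2 * of_real pi * \<i> * (1 / (1 - 0)) + 0)"
  proof (rule Lim_transform_eventually)
    have "(\<lambda>N. qexp z' ^ N) \<longlonglongrightarrow> 0" using norm_qexp_less_1[OF z'] by (rule LIMSEQ_power_zero)
    moreover have "(\<lambda>N. z / of_nat N) \<longlonglongrightarrow> 0"
      by (intro tendsto_divide_0[OF tendsto_const] tendsto_of_nat)
    ultimately show "(\<lambda>N. 2 / z * (of_real pi * \<i> - 2 * of_real pi * \<i> * (1 / (1 - qexp z' ^ N)) + z / of_nat N)) \<longlonglongrightarrow>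
       2 / z * (of_real pi * \<i> - 2 * of_real pi * \<i> * (1 / (1 - 0)) + 0)"
      using norm_qexp_less_1[OF z'] by (intro tendsto_intros) auto
    show "eventually (\<lambda>N. 2 / z * (of_real pi * \<i> - 2 * of_real pi * \<i> * (1 / (1 - qexp z' ^ N)) + z / of_nat N) = W N) sequentially"
      using eventually_ge_at_top[of 1]
    proof eventually_elim
      case (elim N)
      have "Im (of_nat N * z') > 0" using elim z' by simp
      then show ?case using W_eq[OF elim] by (simp add: npow_series_0 qexp_power z'_def)
    qed
  qed
  moreover have "W \<longlonglongrightarrow> (z' ^ 2 * (2 * Lipschitz_const 1 * sigma_series z') - of_real pi ^ 2 / 3 + z' ^ 2 * (of_real pi ^ 2 / 3)) - B"
    unfolding W_def sum_subtractf by (intro tendsto_diff int_partial_sums Rsum hB)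
  ultimately have "(z' ^ 2 * (2 * Lipschitz_const 1 * sigma_series z') - of_real pi ^ 2 / 3 + z' ^ 2 * (of_real pi ^ 2 / 3)) - B
     = 2 / z * (of_real pi * \<i> - 2 * of_real pi * \<i> * (1 / (1 - 0)) + 0)"
    using LIMSEQ_unique by blast
  then have "of_real pi ^ 2 / 3 * (z' ^ 2 * E2 z' - E2 z) = - 2 * of_real pi * \<i> / z"
    unfolding B_eq Lipschitz_const_1 E2_def by (simp add: algebra_simps)
  moreover have "x = - 6 * \<i> / (of_real pi * z)" if "of_real pi ^ 2 / 3 * x = - 2 * of_real pi * \<i> / z" for x
  proof -
    have "x = (of_real pi ^ 2 / 3 * x) * (3 / of_real pi ^ 2)" by simp
    also have "\<dots> = (- 2 * of_real pi * \<i> / z) * (3 / of_real pi ^ 2)" unfolding that ..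
    also have "\<dots> = - 6 * \<i> / (of_real pi * z)" using z0 by (simp add: divide_simps power2_eq_square)
    finally show ?thesis .
  qed
  ultimately have *: "z' ^ 2 * E2 z' - E2 z = - 6 * \<i> / (of_real pi * z)" by blast
  have "z ^ 2 * z' ^ 2 = 1" using z0 by (simp add: z'_def power_divide)
  then have "E2 z' = z ^ 2 * (z' ^ 2 * E2 z')" by (metis mult.assoc mult_1)
  also have "z' ^ 2 * E2 z' = E2 z - 6 * \<i> / (of_real pi * z)" using * by (simp add: algebra_simps)
  also have "z ^ 2 * (E2 z - 6 * \<i> / (of_real pi * z)) = z ^ 2 * E2 z + 6 * z / (of_real pi * \<i>)"
  proof -
    have "z ^ 2 * (6 * \<i> / (of_real pi * z)) = 6 * z * \<i> / of_real pi"
      using z0 by (simp add: power2_eq_square)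
    also have "\<dots> = - (6 * z / (of_real pi * \<i>))" by (simp add: field_simps)
    finally show ?thesis by (simp only: right_diff_distrib diff_minus_eq_add)
  qed
  finally show ?thesis by (simp add: z'_def)
qed

section \<open>The discriminant and cusp forms of weight 10 and 12\<close>

lemma sums_shift_case:
  fixes c :: "nat \<Rightarrow> complex"
  assumes "(\<lambda>n. c n * u ^ Suc n) sums s"
  shows "(\<lambda>n. (case n of 0 \<Rightarrow> 0 | Suc n \<Rightarrow> c n) * u ^ n) sums s"
  using sums_Suc_iff[of "\<lambda>n. (case n of 0 \<Rightarrow> 0 | Suc n \<Rightarrow> c n) * u ^ n" s] assms by simp

lemma power_series_coeff_unique:
  fixes c :: "nat \<Rightarrow> complex"
  assumes "\<And>u. norm u < 1 \<Longrightarrow> (\<lambda>n. c n * u ^ n) sums f u"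
  shows "c n = (deriv ^^ n) f 0 / fact n"
proof -
  have "f has_fps_expansion Abs_fps c"
  proof (rule has_fps_expansionI)
    have "eventually (\<lambda>u :: complex. u \<in> ball 0 1) (nhds 0)"
      by (rule eventually_nhds_in_open) auto
    then show "eventually (\<lambda>u. (\<lambda>n. fps_nth (Abs_fps c) n * u ^ n) sums f u) (nhds 0)"
      by eventually_elim (use assms in auto)
  qed
  from fps_nth_fps_expansion[OF this, of n] show ?thesis by simp
qed

text \<open>
  Minus the logarithm of \<Prod> (1 - u^n), written out as a power series.
\<close>

definition sigma_log :: "complex \<Rightarrow> complex" where
  "sigma_log u = (\<Sum>n. of_nat (divisor_sigma n) / of_nat n * u ^ n)"

lemma summable_sigma_log:
  fixes u :: complex
  assumes "norm u < 1"
  shows "summable (\<lambda>n. of_nat (divisor_sigma n) / of_nat n * u ^ n)"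
proof (rule summable_comparison_test'[OF summable_sigma[OF assms]])
  fix n :: nat
  have "real (divisor_sigma n) / real n \<le> real (divisor_sigma n)"
    by (cases "n = 0") (auto simp: divide_le_eq mult_le_cancel_left1)
  from mult_right_mono[OF this, of "norm u ^ n"]
  show "norm (of_nat (divisor_sigma n) / of_nat n * u ^ n) \<le> norm (of_nat (divisor_sigma n) * u ^ n)"
    by (simp add: norm_mult norm_divide norm_power)
qed

lemma sigma_log_0: "sigma_log 0 = 0"
  unfolding sigma_log_def by (subst powser_zero) simp

lemma sigma_log_holomorphic: "sigma_log holomorphic_on ball 0 1"
proof (rule power_series_holomorphic)
  fix w :: complex assume "w \<in> ball 0 1"
  then show "(\<lambda>n. of_nat (divisor_sigma n) / of_nat n * (w - 0) ^ n) sums sigma_log w"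
    unfolding sigma_log_def using summable_sums[OF summable_sigma_log, of w] by simp
qed

text \<open>
  This is u \<Prod> (1 - u^n)^24.  The exponential form makes both the nonvanishing and the
  logarithmic derivative evident.
\<close>

definition Delta_q :: "complex \<Rightarrow> complex" where
  "Delta_q u = u * exp (- 24 * sigma_log u)"

definition Delta :: "complex \<Rightarrow> complex" where
  "Delta z = Delta_q (qexp z)"

lemma Delta_nonzero: "Delta z \<noteq> 0"
  by (simp add: Delta_def Delta_q_def)

lemma Delta_q_holomorphic: "Delta_q holomorphic_on ball 0 1"
  unfolding Delta_q_def [abs_def] by (intro holomorphic_intros sigma_log_holomorphic)

lemma has_field_derivative_Delta:
  assumes "Im z > 0"
  shows "(Delta has_field_derivative 2 * of_real pi * \<i> * E2 z * Delta z) (at z)"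
proof -
  have "((\<lambda>z. sigma_log (qexp z)) has_field_derivative
     2 * of_real pi * \<i> * (\<Sum>n. of_nat n * (of_nat (divisor_sigma n) / of_nat n) * qexp z ^ n)) (at z)"
    unfolding sigma_log_def by (rule has_field_derivative_qseries[OF summable_sigma_log assms])
  also have "(\<lambda>n. of_nat n * (of_nat (divisor_sigma n) / of_nat n) * qexp z ^ n) = (\<lambda>n. of_nat (divisor_sigma n) * qexp z ^ n)"
  proof
    fix n show "of_nat n * (of_nat (divisor_sigma n) / of_nat n) * qexp z ^ n = of_nat (divisor_sigma n) * qexp z ^ n"
      by (cases "n = 0") auto
  qed
  finally have [derivative_intros]: "((\<lambda>z. sigma_log (qexp z)) has_field_derivative 2 * of_real pi * \<i> * sigma_series z) (at z)"
    by (simp only: sigma_series_def)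
  show ?thesis unfolding Delta_def [abs_def] Delta_q_def E2_def
    by (rule derivative_eq_intros refl)+ (simp add: algebra_simps)
qed

text \<open>
  By E2_S the quotient of the two sides has derivative 0, so it is constant on the upper half
  plane, and it equals 1 at the fixed point i, where i^12 = 1.
\<close>

theorem Delta_S:
  assumes "Im z > 0"
  shows "Delta (- 1 / z) = z ^ 12 * Delta z"
proof -
  define r where "r = (\<lambda>z. Delta (- 1 / z) / (z ^ 12 * Delta z))"
  have "\<exists>c. \<forall>z\<in>{z. Im z > 0}. r z = c"
  proof (rule has_field_derivative_zero_constant)
    show "convex {z. Im z > 0}" by (rule convex_halfspace_Im_gt)
    fix z assume "z \<in> {z. Im z > 0}"
    then have z: "Im z > 0" and z0: "z \<noteq> 0" by auto
    have 1: "((\<lambda>z. Delta (- 1 / z)) has_field_derivative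
        2 * of_real pi * \<i> * E2 (- 1 / z) * Delta (- 1 / z) * (1 / z ^ 2)) (at z)"
      by (rule DERIV_chain2[where f = Delta and g = "\<lambda>z. - 1 / z", OF has_field_derivative_Delta[OF Im_S_pos[OF z]]])
         (use z0 in \<open>auto intro!: derivative_eq_intros simp: power2_eq_square\<close>)
    have "((\<lambda>z :: complex. z ^ 12) has_field_derivative 12 * z ^ 11) (at z)"
      by (auto intro!: derivative_eq_intros)
    from DERIV_mult[OF this has_field_derivative_Delta[OF z]]
    have 2: "((\<lambda>z. z ^ 12 * Delta z) has_field_derivative
        12 * z ^ 11 * Delta z + 2 * of_real pi * \<i> * E2 z * Delta z * z ^ 12) (at z)" .
    have "(r has_field_derivative
       ((2 * of_real pi * \<i> * E2 (- 1 / z) * Delta (- 1 / z) * (1 / z ^ 2)) * (z ^ 12 * Delta z)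
         - Delta (- 1 / z) * (12 * z ^ 11 * Delta z + 2 * of_real pi * \<i> * E2 z * Delta z * z ^ 12)) /
          ((z ^ 12 * Delta z) * (z ^ 12 * Delta z))) (at z)"
      unfolding r_def using z0 Delta_nonzero[of z] by (intro DERIV_divide 1 2) simp
    also have "(2 * of_real pi * \<i> * E2 (- 1 / z) * Delta (- 1 / z) * (1 / z ^ 2)) * (z ^ 12 * Delta z)
         - Delta (- 1 / z) * (12 * z ^ 11 * Delta z + 2 * of_real pi * \<i> * E2 z * Delta z * z ^ 12) = 0"
    proof -
      have *: "2 * of_real pi * \<i> * (6 * z / (of_real pi * \<i>)) = 12 * z" by simp
      have e: "2 * of_real pi * \<i> * E2 (- 1 / z) = 2 * of_real pi * \<i> * (z ^ 2 * E2 z) + 12 * z"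
        unfolding E2_S[OF z] distrib_left * ..
      have p: "(1 / z ^ 2) * z ^ 12 = z ^ 10" "z ^ 10 * z ^ 2 = z ^ 12" "z ^ 10 * z = z ^ 11"
        using z0 by (simp_all add: field_simps flip: power_add power_Suc power_Suc2)
      define X Y A B where "X = 2 * of_real pi * \<i> * E2 (- 1 / z)" "Y = 2 * of_real pi * \<i> * E2 z"
        "A = Delta (- 1 / z)" "B = Delta z"
      have "X * A * (1 / z ^ 2) * (z ^ 12 * B) = X * A * B * (1 / z ^ 2 * z ^ 12)"
        by (simp only: mult_ac)
      also have "\<dots> = (Y * z ^ 2 + 12 * z) * A * B * z ^ 10"
        using e unfolding p(1) X_Y_A_B_def by (simp only: mult_ac)
      also have "\<dots> = A * (12 * (z ^ 10 * z) * B + Y * B * (z ^ 10 * z ^ 2))"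
        by (simp only: algebra_simps)
      finally show ?thesis unfolding p X_Y_A_B_def by simp
    qed
    finally have "(r has_field_derivative 0) (at z)" by simp
    then show "(r has_field_derivative 0) (at z within {z. Im z > 0})"
      by (rule has_field_derivative_at_within)
  qed
  then obtain c where c: "\<And>z. Im z > 0 \<Longrightarrow> r z = c" by auto
  have "\<i> ^ 12 = (1 :: complex)" by (simp add: power_numeral_reduce)
  then have "r \<i> = 1" using Delta_nonzero[of \<i>] by (simp add: r_def)
  then have "r z = 1" using c[of \<i>] c[OF assms] by simp
  moreover have "z ^ 12 * Delta z \<noteq> 0" using assms Delta_nonzero by auto
  ultimately show ?thesis by (simp add: r_def)
qed

text \<open>
  If |Re z| \<le> 1/2 and Im z < 1/2, then |z|^2 < 1/2, so z \<mapsto> -1/z at least doubles the imaginary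
  part.  Translations and finitely many such steps thus lead to Im z \<ge> 1/2.
\<close>

lemma orbit_representative:
  fixes H :: "complex \<Rightarrow> 'a"
  assumes inv: "\<And>z. Im z > 0 \<Longrightarrow> H (qexp (- 1 / z)) = H (qexp z)"
  assumes "Im z > 0"
  obtains z' where "Im z' \<ge> 1 / 2" "H (qexp z') = H (qexp z)"
proof -
  have ex: "\<exists>z'. Im z' \<ge> 1 / 2 \<and> H (qexp z') = H (qexp z)" if "Im z \<ge> (1 / 2) ^ Suc n" for n z
    using that
  proof (induction n arbitrary: z)
    case 0
    then show ?case by auto
  next
    case (Suc n)
    define z1 where "z1 = z + of_int (- round (Re z))"
    have n1: "qexp z1 = qexp z" unfolding z1_def by (rule qexp_add_int)
    have im: "Im z1 = Im z" by (simp add: z1_def)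
    have re: "\<bar>Re z1\<bar> \<le> 1 / 2" using of_int_round_abs_le[of "Re z"] by (simp add: z1_def abs_minus_commute)
    show ?case
    proof (cases "Im z1 \<ge> 1 / 2")
      case True
      then show ?thesis using n1 by metis
    next
      case False
      have pos: "Im z1 > 0" using Suc.prems im by (metis less_le_trans zero_less_divide_1_iff zero_less_numeral zero_less_power)
      have "(Re z1)\<^sup>2 \<le> (1 / 2)\<^sup>2" using re by (metis abs_le_square_iff abs_of_pos half_gt_zero_iff zero_less_one)
      moreover have "(Im z1)\<^sup>2 \<le> (1 / 2)\<^sup>2" using False pos by (intro power_mono) auto
      ultimately have "norm z1 ^ 2 \<le> 1 / 2" unfolding cmod_power2 by (simp add: power2_eq_square)
      moreover have "norm z1 ^ 2 > 0" using pos by auto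
      ultimately have "Im z1 / norm z1 ^ 2 \<ge> 2 * Im z1" using pos by (simp add: field_simps)
      moreover have "Im (- 1 / z1) = Im z1 / norm z1 ^ 2"
        using Im_moebius_pos(2)[OF pos, of 0 0 "-1" 1] by simp
      moreover have "(1 / 2 :: real) ^ Suc n = 2 * (1 / 2) ^ Suc (Suc n)" by simp
      ultimately have "Im (- 1 / z1) \<ge> (1 / 2) ^ Suc n" using Suc.prems im by linarith
      from Suc.IH[OF this] inv[OF pos] n1 show ?thesis by metis
    qed
  qed
  obtain n where "(1 / 2) ^ n < Im z" using real_arch_pow_inv[OF assms(2), of "1 / 2"] by auto
  moreover have "(1 / 2 :: real) ^ Suc n \<le> (1 / 2) ^ n" by simp
  ultimately have "Im z \<ge> (1 / 2) ^ Suc n" by linarith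
  from ex[OF this] that show ?thesis by blast
qed

text \<open>
  Every orbit meets Im z \<ge> 1/2, so all values of H in the open disc are already taken on the compact
  disc of radius exp (-\<pi>).  The maximum of |H| is therefore attained in the interior.
\<close>

theorem invariant_imp_constant:
  assumes hol: "H holomorphic_on ball 0 1"
  assumes inv: "\<And>z. Im z > 0 \<Longrightarrow> H (qexp (- 1 / z)) = H (qexp z)"
  assumes u: "norm u < 1"
  shows "H u = H 0"
proof -
  define K :: "complex set" where "K = cball 0 (exp (- pi))"
  have K: "K \<subseteq> ball 0 1" "compact K" "0 \<in> K" 
    unfolding K_def using exp_less_one_iff[of "- pi"] pi_gt_zero by (auto simp del: exp_less_one_iff)
  have "continuous_on K (\<lambda>u. norm (H u))"
    using holomorphic_on_imp_continuous_on[OF hol] K by (intro continuous_intros) (rule continuous_on_subset)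
  then obtain u0 where u0: "u0 \<in> K" "\<And>u. u \<in> K \<Longrightarrow> norm (H u) \<le> norm (H u0)"
    using continuous_attains_sup[OF K(2), of "\<lambda>u. norm (H u)"] K(3) by auto
  have max: "norm (H u) \<le> norm (H u0)" if "u \<in> ball 0 1" for u
  proof (cases "u = 0")
    case True
    then show ?thesis using u0 K by auto
  next
    case False
    then obtain z where z: "Im z > 0" "qexp z = u" using qexp_surj \<open>u \<in> ball 0 1\<close> by (metis dist_0_norm mem_ball)
    obtain z' where z': "Im z' \<ge> 1 / 2" "H (qexp z') = H (qexp z)"
      using orbit_representative[of H, OF inv z(1)] by metis
    have "pi * 1 \<le> pi * (2 * Im z')" using z'(1) by (intro mult_left_mono) auto
    then have "qexp z' \<in> K" by (simp add: K_def norm_qexp)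
    then show ?thesis using u0 z z' by metis
  qed
  have "H constant_on ball 0 1"
    by (rule maximum_modulus_principle[where U = "ball 0 1" and \<xi> = u0]) (use hol max u0 K in auto)
  then show ?thesis using u unfolding constant_on_def by (metis centre_in_ball dist_0_norm mem_ball zero_less_one)
qed

text \<open>
  The convergence of the expansion at every point of the upper half plane makes it a power series in
  the whole unit disc, divisible by q.
\<close>

lemma cusp_series:
  assumes f: "\<And>z. Im z > 0 \<Longrightarrow> (\<lambda>n. c n * qexp z ^ Suc n) sums f z"
  obtains \<Psi> where "\<Psi> holomorphic_on ball 0 1" "\<Psi> 0 = c 0"
    "\<And>u. norm u < 1 \<Longrightarrow> (\<lambda>n. c n * u ^ n) sums \<Psi> u"
    "\<And>z. Im z > 0 \<Longrightarrow> f z = qexp z * \<Psi> (qexp z)"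
proof
  define \<Psi> where "\<Psi> = (\<lambda>u. \<Sum>n. c n * u ^ n)"
  show sums: "(\<lambda>n. c n * u ^ n) sums \<Psi> u" if u: "norm u < 1" for u
  proof (cases "u = 0")
    case True
    then show ?thesis unfolding \<Psi>_def using powser_sums_zero[of c] by (simp add: sums_iff)
  next
    case False
    then obtain z where z: "Im z > 0" "qexp z = u" using qexp_surj u by metis
    have "(\<lambda>n. 1 / u * (c n * u ^ Suc n)) sums (1 / u * f z)"
      by (intro sums_mult) (use f[OF z(1)] z(2) in simp)
    then have "summable (\<lambda>n. c n * u ^ n)" using False by (simp add: sums_iff)
    then show ?thesis unfolding \<Psi>_def by (rule summable_sums)
  qed
  show "\<Psi> holomorphic_on ball 0 1"
    by (rule power_series_holomorphic[where a = c]) (use sums in auto)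
  have "(\<lambda>n. c n * 0 ^ n) sums \<Psi> 0" by (rule sums) simp
  then show "\<Psi> 0 = c 0" using powser_sums_zero sums_unique2 by blast
  fix z assume z: "Im z > 0"
  have "(\<lambda>n. qexp z * (c n * qexp z ^ n)) sums (qexp z * \<Psi> (qexp z))"
    by (intro sums_mult sums norm_qexp_less_1 z)
  then show "f z = qexp z * \<Psi> (qexp z)" using f[OF z] sums_unique2 by (simp add: mult_ac)
qed

definition Delta_coeff :: "nat \<Rightarrow> complex" where
  "Delta_coeff n = (deriv ^^ n) Delta_q 0 / fact n"

lemma Delta_q_sums: "norm u < 1 \<Longrightarrow> (\<lambda>n. Delta_coeff n * u ^ n) sums Delta_q u"
  unfolding Delta_coeff_def using holomorphic_power_series[OF Delta_q_holomorphic, of u] by simp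

lemma Delta_coeff_0: "Delta_coeff 0 = 0"
  by (simp add: Delta_coeff_def Delta_q_def)

text \<open>
  The quotient f / \<Delta> has weight 0 and is holomorphic in q, including at q = 0, because the zero of
  \<Delta> there is simple.  Hence it is constant.
\<close>

theorem cusp_form_12:
  assumes f: "\<And>z. Im z > 0 \<Longrightarrow> (\<lambda>n. c n * qexp z ^ Suc n) sums f z"
  assumes S: "\<And>z. Im z > 0 \<Longrightarrow> f (- 1 / z) = z ^ 12 * f z"
  shows "c n = c 0 * Delta_coeff (Suc n)" "Im z > 0 \<Longrightarrow> f z = c 0 * Delta z"
proof -
  obtain \<Psi> where P: "\<Psi> holomorphic_on ball 0 1" "\<Psi> 0 = c 0"
    "\<And>u. norm u < 1 \<Longrightarrow> (\<lambda>n. c n * u ^ n) sums \<Psi> u"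
    "\<And>z. Im z > 0 \<Longrightarrow> f z = qexp z * \<Psi> (qexp z)"
    using cusp_series[of c f, OF f] by metis
  define H where "H = (\<lambda>u. \<Psi> u / exp (- 24 * sigma_log u))"
  have H: "H u = H 0" if "norm u < 1" for u
  proof (rule invariant_imp_constant[OF _ _ that])
    show "H holomorphic_on ball 0 1"
      unfolding H_def by (intro holomorphic_intros P sigma_log_holomorphic) auto
    fix z assume z: "Im z > 0"
    have H_eq: "H (qexp z) = f z / Delta z" if "Im z > 0" for z
      using P(4)[OF that] by (simp add: H_def Delta_def Delta_q_def)
    have "z \<noteq> 0" using z by auto
    then show "H (qexp (- 1 / z)) = H (qexp z)"
      unfolding H_eq[OF z] H_eq[OF Im_S_pos[OF z]] S[OF z] Delta_S[OF z] by simp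
  qed
  have H0: "H 0 = c 0" by (simp add: H_def P(2) sigma_log_0)
  have eq: "\<Psi> u = c 0 * exp (- 24 * sigma_log u)" if "norm u < 1" for u
    using H[OF that] by (simp add: H0) (simp add: H_def field_simps)
  show fz: "Im z > 0 \<Longrightarrow> f z = c 0 * Delta z" for z
    using P(4) eq norm_qexp_less_1 by (simp add: Delta_def Delta_q_def)
  have "(\<lambda>n. (case n of 0 \<Rightarrow> 0 | Suc n \<Rightarrow> c n) * u ^ n) sums (c 0 * Delta_q u)" if "norm u < 1" for u
  proof -
    have "(\<lambda>n. u * (c n * u ^ n)) sums (u * \<Psi> u)" by (intro sums_mult P(3) that)
    then have "(\<lambda>n. c n * u ^ Suc n) sums (c 0 * Delta_q u)"
      by (simp add: eq[OF that] Delta_q_def mult_ac)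
    then show ?thesis by (rule sums_shift_case)
  qed
  from power_series_coeff_unique[of _ "\<lambda>u. c 0 * Delta_q u" "Suc n", OF this]
  have "c n = (deriv ^^ Suc n) (\<lambda>u. c 0 * Delta_q u) 0 / fact (Suc n)" by simp
  moreover have "c 0 * Delta_coeff (Suc n) = (deriv ^^ Suc n) (\<lambda>u. c 0 * Delta_q u) 0 / fact (Suc n)"
  proof (rule power_series_coeff_unique[where c = "\<lambda>n. c 0 * Delta_coeff n"])
    show "(\<lambda>n. c 0 * Delta_coeff n * u ^ n) sums (c 0 * Delta_q u)" if "norm u < 1" for u
      using sums_mult[OF Delta_q_sums[OF that], of "c 0"] by (simp add: mult_ac)
  qed
  ultimately show "c n = c 0 * Delta_coeff (Suc n)" by simp
qed

text \<open>
  The quotient f^6 / \<Delta>^5 has weight 60 - 60 = 0 and vanishes at q = 0, because the numerator has a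
  zero of order at least 6 and the denominator one of order 5.  Hence it is 0.
\<close>

theorem cusp_form_10:
  assumes f: "\<And>z. Im z > 0 \<Longrightarrow> (\<lambda>n. c n * qexp z ^ Suc n) sums f z"
  assumes S: "\<And>z. Im z > 0 \<Longrightarrow> f (- 1 / z) = z ^ 10 * f z"
  shows "c n = 0"
proof -
  obtain \<Psi> where P: "\<Psi> holomorphic_on ball 0 1" "\<Psi> 0 = c 0"
    "\<And>u. norm u < 1 \<Longrightarrow> (\<lambda>n. c n * u ^ n) sums \<Psi> u"
    "\<And>z. Im z > 0 \<Longrightarrow> f z = qexp z * \<Psi> (qexp z)"
    using cusp_series[of c f, OF f] by metis
  define H where "H = (\<lambda>u. u * \<Psi> u ^ 6 / exp (- 24 * sigma_log u) ^ 5)"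
  have H: "H u = H 0" if "norm u < 1" for u
  proof (rule invariant_imp_constant[OF _ _ that])
    show "H holomorphic_on ball 0 1"
      unfolding H_def by (intro holomorphic_intros P sigma_log_holomorphic) auto
    fix z assume z: "Im z > 0"
    have H_eq: "H (qexp z) = f z ^ 6 / Delta z ^ 5" if "Im z > 0" for z
      using P(4)[OF that] by (simp add: H_def Delta_def Delta_q_def power_mult_distrib field_simps power_numeral_reduce)
    have "z \<noteq> 0" using z by auto
    then show "H (qexp (- 1 / z)) = H (qexp z)"
      unfolding H_eq[OF z] H_eq[OF Im_S_pos[OF z]] S[OF z] Delta_S[OF z]
      by (simp add: power_mult_distrib flip: power_mult)
  qed
  have "f z = 0" if "Im z > 0" for z
    using H[OF norm_qexp_less_1[OF that]] P(4)[OF that] by (simp add: H_def)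
  then have eq: "\<Psi> u = 0" if "norm u < 1" "u \<noteq> 0" for u
    using that P(4) qexp_surj by (metis mult_eq_0_iff)
  have "(\<lambda>n. (case n of 0 \<Rightarrow> 0 | Suc n \<Rightarrow> c n) * u ^ n) sums 0" if "norm u < 1" for u
  proof -
    have "(\<lambda>n. u * (c n * u ^ n)) sums (u * \<Psi> u)" by (intro sums_mult P(3) that)
    moreover have "u * \<Psi> u = 0" using eq[OF that] by auto
    ultimately have "(\<lambda>n. c n * u ^ Suc n) sums 0"
      by (simp add: mult_ac)
    then show ?thesis by (rule sums_shift_case)
  qed
  from power_series_coeff_unique[of _ "\<lambda>u. 0" "Suc n", OF this]
  show ?thesis by (simp add: higher_deriv_const)
qed

text \<open>
  Applying the classification in weight 12 to \<Delta> itself compares \<Delta> with its first coefficient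
  times \<Delta>.
\<close>

lemma Delta_coeff_1: "Delta_coeff 1 = 1"
proof -
  have "(\<lambda>n. Delta_coeff (Suc n) * qexp z ^ Suc n) sums Delta z" if "Im z > 0" for z
    using Delta_q_sums[OF norm_qexp_less_1[OF that]] 
    by (subst sums_Suc_iff) (simp add: Delta_def Delta_coeff_0)
  from cusp_form_12(2)[OF this Delta_S, of \<i>] show ?thesis
    using Delta_nonzero[of \<i>] by simp
qed

section \<open>The kernel function of SL(2,Z) and Poincare series\<close>

type_synonym mat = "(int \<times> int) \<times> (int \<times> int)"

definition SL2 :: "mat set" where
  "SL2 = {((a, b), (c, d)). a * d - b * c = 1}"

definition kform :: "complex \<Rightarrow> complex \<Rightarrow> mat \<Rightarrow> complex" where
  "kform z w = (\<lambda>((a, b), (c, d)). of_int a * z + of_int b + w * (of_int c * z + of_int d))"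

text \<open>
  The form is j (g z + w) with j the automorphy factor of g at z.  So this is the reproducing kernel
  of weight k, with w in place of the negative conjugate of the second variable.
\<close>

definition SL2_kernel :: "nat \<Rightarrow> complex \<Rightarrow> complex \<Rightarrow> complex" where
  "SL2_kernel k z w = (\<Sum>\<^sub>\<infinity>g\<in>SL2. 1 / kform z w g ^ k)"

text \<open>
  With v = c z + d and u = a z + b the form is v (u/v + w), and Im (u/v) > 0 because the
  determinant is 1.  So the form is at least |v| Im w, which also bounds u.
\<close>

lemma kform_bound:
  assumes z: "Im z > 0" and w: "Im w > 0" and g: "((a, b), (c, d)) \<in> SL2"
  shows "kform z w ((a, b), (c, d)) \<noteq> 0"
    "norm (of_int c * z + of_int d) \<le> (1 + (1 + norm w) / Im w) * norm (kform z w ((a, b), (c, d)))"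
    "norm (of_int a * z + of_int b) \<le> (1 + (1 + norm w) / Im w) * norm (kform z w ((a, b), (c, d)))"
proof -
  define u v X where uvX: "u = of_int a * z + of_int b" "v = of_int c * z + of_int d" "X = kform z w ((a, b), (c, d))"
  have det: "a * d - b * c = 1" using g by (simp add: SL2_def)
  have X: "X = u + w * v" by (simp add: uvX kform_def)
  have v0: "v \<noteq> 0" and im: "Im (u / v) > 0" using Im_moebius_pos[OF z det] by (simp_all add: uvX)
  have "Im w \<le> Im (u / v + w)" using im by simp
  also have "\<dots> \<le> norm (u / v + w)" using abs_Im_le_cmod[of "u / v + w"] by linarith
  finally have "norm v * Im w \<le> norm v * norm (u / v + w)" by (intro mult_left_mono) auto
  also have "\<dots> = norm X" 
  proof -
    have "v * (u / v + w) = X" using v0 by (simp add: X distrib_left mult.commute)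
    then show ?thesis by (metis norm_mult)
  qed
  finally have *: "norm v * Im w \<le> norm X" .
  have "0 < norm v * Im w" using v0 w by simp
  with * have "X \<noteq> 0" by auto
  then show "kform z w ((a, b), (c, d)) \<noteq> 0" by (simp add: uvX)
  have v: "norm v \<le> 1 / Im w * norm X" using * w by (simp add: field_simps)
  also have "\<dots> \<le> (1 + (1 + norm w) / Im w) * norm X"
    using w by (intro mult_right_mono) (auto simp: field_simps)
  finally show "norm (of_int c * z + of_int d) \<le> (1 + (1 + norm w) / Im w) * norm (kform z w ((a, b), (c, d)))"
    by (simp add: uvX)
  have "norm u = norm (X - w * v)" by (simp add: X)
  also have "\<dots> \<le> norm X + norm w * norm v" by (metis norm_triangle_ineq4 norm_mult)
  also have "\<dots> \<le> norm X + norm w * (1 / Im w * norm X)" by (intro add_left_mono mult_left_mono v) auto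
  also have "\<dots> = (1 + norm w / Im w) * norm X" by (simp add: algebra_simps)
  also have "\<dots> \<le> (1 + (1 + norm w) / Im w) * norm X"
    using w by (intro mult_right_mono) (auto simp: field_simps)
  finally show "norm (of_int a * z + of_int b) \<le> (1 + (1 + norm w) / Im w) * norm (kform z w ((a, b), (c, d)))"
    by (simp add: uvX)
qed

text \<open>
  The form dominates both rows, hence its power 2 p dominates the product of the p-th powers of the
  two rows, and the sum over SL(2,Z) is at most a product of two lattice sums.
\<close>

theorem summable_SL2_kernel:
  assumes z: "Im z > 0" and w: "Im w > 0" and p: "p \<ge> 3"
  shows "(\<lambda>g. norm (1 / kform z w g ^ (2 * p))) summable_on SL2"
proof -
  define \<kappa> where "\<kappa> = 1 + (1 + norm w) / Im w"
  have \<kappa>: "\<kappa> > 0" using w by (auto simp: \<kappa>_def intro!: add_pos_nonneg)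
  let ?f = "\<lambda>(c,d). 1 / norm (of_int c * z + of_int d) ^ p"
  have "(\<lambda>(x,y). ?f x * ?f y) summable_on (UNIV :: (int \<times> int) set) \<times> (UNIV :: (int \<times> int) set)"
    by (intro summable_on_product_nonneg summable_lattice[OF z p]) auto
  then have "(\<lambda>x. \<kappa> ^ (2 * p) * (case x of (x,y) \<Rightarrow> ?f x * ?f y)) summable_on (UNIV :: (int \<times> int) set) \<times> (UNIV :: (int \<times> int) set)"
    by (rule summable_on_cmult_right)
  then have "(\<lambda>x. \<kappa> ^ (2 * p) * (case x of (x,y) \<Rightarrow> ?f x * ?f y)) summable_on SL2"
    by (rule summable_on_subset_banach) auto
  then show ?thesis
  proof (rule summable_on_comparison_test, goal_cases)
    case (1 g)
    obtain a b c d where g: "g = ((a,b),(c,d))" by (metis surj_pair)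
    define u v X where uvX: "u = of_int a * z + of_int b" "v = of_int c * z + of_int d" "X = kform z w ((a, b), (c, d))"
    have b: "X \<noteq> 0" "norm v \<le> \<kappa> * norm X" "norm u \<le> \<kappa> * norm X"
      using kform_bound[OF z w 1[unfolded g]] by (simp_all add: uvX \<kappa>_def)
    have nz: "u \<noteq> 0" "v \<noteq> 0"
    proof -
      have "a * d - b * c = 1" using 1 g by (simp add: SL2_def)
      then have "a \<noteq> 0 \<or> b \<noteq> 0" "c \<noteq> 0 \<or> d \<noteq> 0" by auto
      then show "u \<noteq> 0" "v \<noteq> 0" unfolding uvX by (auto simp only: lattice_form_nonzero[OF z])
    qed
    have "norm u ^ p * norm v ^ p \<le> (\<kappa> * norm X) ^ p * (\<kappa> * norm X) ^ p"
      using b \<kappa> by (intro mult_mono power_mono) auto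
    also have "\<dots> = \<kappa> ^ (2 * p) * norm X ^ (2 * p)"
      by (simp add: power_mult_distrib mult_2 power_add)
    finally have "1 / norm X ^ (2 * p) \<le> \<kappa> ^ (2 * p) * (1 / norm u ^ p * (1 / norm v ^ p))"
      using nz b(1) by (simp add: field_simps)
    then show ?case by (simp add: g uvX norm_divide norm_power mult.commute)
  qed auto
qed

text \<open>
  Replacing w by its image multiplies the form by 1 / (\<gamma> w + \<delta>) and permutes SL(2,Z) by
  multiplication with a fixed matrix.
\<close>

theorem SL2_kernel_modular:
  fixes \<alpha> \<beta> \<gamma> \<delta> :: int
  assumes det: "\<alpha> * \<delta> - \<beta> * \<gamma> = 1" and w: "Im w > 0"
  shows "SL2_kernel k z ((of_int \<alpha> * w + of_int \<beta>) / (of_int \<gamma> * w + of_int \<delta>)) = (of_int \<gamma> * w + of_int \<delta>) ^ k * SL2_kernel k z w"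
proof -
  let ?j = "of_int \<gamma> * w + of_int \<delta> :: complex"
  let ?w = "(of_int \<alpha> * w + of_int \<beta>) / ?j"
  have j: "?j \<noteq> 0" using Im_moebius_pos(1)[OF w det] .
  let ?T = "\<lambda>((a, b), (c, d)). ((\<delta> * a + \<beta> * c, \<delta> * b + \<beta> * d), (\<gamma> * a + \<alpha> * c, \<gamma> * b + \<alpha> * d)) :: mat"
  let ?U = "\<lambda>((a, b), (c, d)). ((\<alpha> * a - \<beta> * c, \<alpha> * b - \<beta> * d), (\<delta> * c - \<gamma> * a, \<delta> * d - \<gamma> * b)) :: mat"
  have key: "x * (\<alpha> * \<delta>) - x * (\<beta> * \<gamma>) = x" for x
    using det by (metis mult.right_neutral right_diff_distrib)
  have "SL2_kernel k z ?w = (\<Sum>\<^sub>\<infinity>g\<in>SL2. ?j ^ k * (1 / kform z w g ^ k))"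
    unfolding SL2_kernel_def
  proof (rule infsum_reindex_bij_witness[of _ ?U ?T], goal_cases)
    case (1 g)
    obtain a b c d where g: "g = ((a,b),(c,d))" by (metis surj_pair)
    have "\<alpha> * (\<delta> * x + \<beta> * y) - \<beta> * (\<gamma> * x + \<alpha> * y) = x" "\<delta> * (\<gamma> * x + \<alpha> * y) - \<gamma> * (\<delta> * x + \<beta> * y) = y" for x y
      using key[of x] key[of y] by (simp_all add: algebra_simps)
    then show ?case by (simp add: g)
  next
    case (2 g)
    obtain a b c d where g: "g = ((a,b),(c,d))" by (metis surj_pair)
    have "(\<delta> * a + \<beta> * c) * (\<gamma> * b + \<alpha> * d) - (\<delta> * b + \<beta> * d) * (\<gamma> * a + \<alpha> * c) = (\<alpha> * \<delta> - \<beta> * \<gamma>) * (a * d - b * c)"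
      by (simp add: algebra_simps)
    then show ?case using 2 det by (simp add: g SL2_def)
  next
    case (3 g)
    obtain a b c d where g: "g = ((a,b),(c,d))" by (metis surj_pair)
    have "\<delta> * (\<alpha> * x - \<beta> * y) + \<beta> * (\<delta> * y - \<gamma> * x) = x" "\<gamma> * (\<alpha> * x - \<beta> * y) + \<alpha> * (\<delta> * y - \<gamma> * x) = y" for x y
      using key[of x] key[of y] by (simp_all add: algebra_simps)
    then show ?case by (simp add: g)
  next
    case (4 g)
    obtain a b c d where g: "g = ((a,b),(c,d))" by (metis surj_pair)
    have "(\<alpha> * a - \<beta> * c) * (\<delta> * d - \<gamma> * b) - (\<alpha> * b - \<beta> * d) * (\<delta> * c - \<gamma> * a) = (\<alpha> * \<delta> - \<beta> * \<gamma>) * (a * d - b * c)"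
      by (simp add: algebra_simps)
    then show ?case using 4 det by (simp add: g SL2_def)
  next
    case (5 g)
    obtain a b c d where g: "g = ((a,b),(c,d))" by (metis surj_pair)
    have "kform z w (?T g) = ?j * kform z ?w g"
      using j by (simp add: g kform_def field_simps)
    then show ?case using j by (simp add: power_mult_distrib)
  qed
  also have "\<dots> = ?j ^ k * SL2_kernel k z w"
    unfolding SL2_kernel_def by (rule infsum_cmult_right')
  finally show ?thesis .
qed

corollary SL2_kernel_S:
  assumes "Im w > 0"
  shows "SL2_kernel k z (- 1 / w) = w ^ k * SL2_kernel k z w"
  using SL2_kernel_modular[of 0 0 "-1" 1 w k z] assms by simp

text \<open>
  Bottom rows label the cosets of the group of translations; a row and its negative both occur, so
  every sum over them counts each coset of the modular group twice.
\<close>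

definition bottom_rows :: "(int \<times> int) set" where
  "bottom_rows = {(c, d). coprime c d}"

definition top_row :: "int \<times> int \<Rightarrow> int \<times> int" where
  "top_row = (\<lambda>(c, d). SOME (a, b). a * d - b * c = 1)"

definition cocycle :: "int \<times> int \<Rightarrow> complex \<Rightarrow> complex" where
  "cocycle = (\<lambda>(c, d) z. of_int c * z + of_int d)"

definition coset_act :: "int \<times> int \<Rightarrow> complex \<Rightarrow> complex" where
  "coset_act r z = cocycle (top_row r) z / cocycle r z"

text \<open>
  The matrices with bottom row r: any one of them, multiplied from the left by the translation by n.
\<close>

definition shear :: "int \<times> int \<Rightarrow> int \<Rightarrow> mat" where
  "shear r n = ((fst (top_row r) + n * fst r, snd (top_row r) + n * snd r), r)"

lemma top_row:
  assumes "(c, d) \<in> bottom_rows"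
  shows "fst (top_row (c, d)) * d - snd (top_row (c, d)) * c = 1"
proof -
  have "gcd d (- c) = 1" using assms by (simp add: bottom_rows_def coprime_iff_gcd_eq_1 gcd.commute)
  then obtain u v where "u * d + v * (- c) = 1" using bezout_int[of d "- c"] by auto
  then have "\<exists>p. case p of (a, b) \<Rightarrow> a * d - b * c = 1" by (intro exI[of _ "(u, v)"]) simp
  then have "case top_row (c, d) of (a, b) \<Rightarrow> a * d - b * c = 1"
    unfolding top_row_def by (simp add: someI_ex)
  then show ?thesis by (simp add: case_prod_unfold)
qed

text \<open>
  Unfolding: summation over SL(2,Z) as summation over bottom rows and translations.  The translation
  that leads from the chosen top row (a0,b0) to (a,b) is the determinant b a0 - a b0.
\<close>

lemma SL2_unfold:
  "(F has_sum S) SL2 \<longleftrightarrow> ((\<lambda>(r, n). F (shear r n)) has_sum S) (bottom_rows \<times> UNIV)"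
proof (rule sym, rule has_sum_reindex_bij_witness[of _
    "\<lambda>((a, b), (c, d)). ((c, d), b * fst (top_row (c, d)) - a * snd (top_row (c, d)))" "\<lambda>(r, n). shear r n"], goal_cases)
  case (1 x)
  then obtain c d n where x: "x = ((c, d), n)" "(c, d) \<in> bottom_rows" by force
  define a b where "a = fst (top_row (c, d))" "b = snd (top_row (c, d))"
  have "a * d - b * c = 1" using top_row[OF x(2)] by (simp add: a_b_def)
  moreover have "(b + n * d) * a - (a + n * c) * b = n * (a * d - b * c)" by (simp add: algebra_simps)
  ultimately show ?case by (simp add: x shear_def a_b_def)
next
  case (2 x)
  then obtain c d n where x: "x = ((c, d), n)" "(c, d) \<in> bottom_rows" by force
  then show ?case using top_row[OF x(2)] by (simp add: shear_def SL2_def algebra_simps)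
next
  case (3 g)
  then obtain a b c d where g: "g = ((a,b),(c,d))" "a * d - b * c = 1" by (auto simp: SL2_def)
  then have "coprime c d" by (metis coprimeI dvd_diff dvd_mult dvd_mult2 mult.commute)
  then have r: "(c, d) \<in> bottom_rows" by (simp add: bottom_rows_def)
  define a0 b0 where "a0 = fst (top_row (c, d))" "b0 = snd (top_row (c, d))"
  have d0: "a0 * d - b0 * c = 1" using top_row[OF r] by (simp add: a0_b0_def)
  have "a0 + (b * a0 - a * b0) * c = a0 * (1 - (a * d - b * c)) + a * (a0 * d - b0 * c)" by (simp add: algebra_simps)
  moreover have "b0 + (b * a0 - a * b0) * d = b0 * (1 - (a * d - b * c)) + b * (a0 * d - b0 * c)" by (simp add: algebra_simps)
  ultimately show ?case using g d0 by (simp add: shear_def a0_b0_def)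
next
  case (4 g)
  then obtain a b c d where g: "g = ((a,b),(c,d))" "a * d - b * c = 1" by (auto simp: SL2_def)
  then have "coprime c d" by (metis coprimeI dvd_diff dvd_mult dvd_mult2 mult.commute)
  then show ?case by (simp add: g bottom_rows_def)
qed auto

lemma coset_act_props:
  assumes z: "Im z > 0" and r: "r \<in> bottom_rows"
  shows "cocycle r z \<noteq> 0" "Im (coset_act r z) = Im z / norm (cocycle r z) ^ 2" "Im (coset_act r z) > 0"
proof -
  obtain c d where cd: "r = (c, d)" by force
  have det: "fst (top_row (c, d)) * d - snd (top_row (c, d)) * c = 1"
    using top_row r cd by blast
  show "cocycle r z \<noteq> 0" "Im (coset_act r z) = Im z / norm (cocycle r z) ^ 2" "Im (coset_act r z) > 0"
    using Im_moebius_pos[OF z det] by (simp_all add: cd coset_act_def cocycle_def case_prod_unfold)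
qed

lemma kform_shear:
  assumes z: "Im z > 0" and r: "r \<in> bottom_rows"
  shows "kform z w (shear r n) = cocycle r z * (coset_act r z + w + of_int n)"
  using coset_act_props(1)[OF z r]
  by (simp add: kform_def shear_def coset_act_def cocycle_def case_prod_unfold field_simps)

lemma summable_cocycle:
  assumes z: "Im z > 0" and p: "p \<ge> 3"
  shows "(\<lambda>r. norm (1 / cocycle r z ^ p)) summable_on bottom_rows"
proof -
  have "(\<lambda>(c,d). 1 / norm (of_int c * z + of_int d) ^ p) summable_on bottom_rows"
    using summable_lattice[OF z p] by (rule summable_on_subset_banach) auto
  then show ?thesis by (simp add: cocycle_def case_prod_unfold norm_divide norm_power)
qed

lemma coset_series_abs_summable:
  assumes z: "Im z > 0" and w: "Im w > 0" and k: "k \<ge> 1"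
    and A: "(\<lambda>r. norm (A r)) summable_on bottom_rows"
  shows "(\<lambda>x. norm (case x of (r, N) \<Rightarrow> A r * (of_nat N ^ k * qexp (coset_act r z + w) ^ N)))
            summable_on bottom_rows \<times> {1..}"
proof -
  define G where "G = (\<lambda>(r, N). A r * (of_nat N ^ k * qexp (coset_act r z + w) ^ N))"
  have "(\<lambda>(r, N). norm (A r) * norm (of_nat N ^ k * qexp w ^ N)) summable_on bottom_rows \<times> {1..}"
    by (intro summable_on_product_nonneg A has_sum_npow_series(2) w k) auto
  then have "(\<lambda>x. norm (G x)) summable_on bottom_rows \<times> {1..}"
  proof (rule summable_on_comparison_test, goal_cases)
    case (1 x)
    then obtain r N where x: "x = (r, N)" "r \<in> bottom_rows" by auto
    have "norm (qexp (coset_act r z)) ^ N \<le> 1"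
      using norm_qexp_less_1[OF coset_act_props(3)[OF z x(2)]] by (intro power_le_one) auto
    then have "norm (qexp (coset_act r z)) ^ N * norm (qexp w) ^ N \<le> 1 * norm (qexp w) ^ N"
      by (intro mult_right_mono) auto
    then have "norm (A r) * (real N ^ k * (norm (qexp (coset_act r z)) ^ N * norm (qexp w) ^ N)) \<le> norm (A r) * (real N ^ k * norm (qexp w) ^ N)"
      by (intro mult_left_mono) auto
    then show ?case by (simp add: x G_def norm_mult norm_power qexp_add power_mult_distrib)
  qed auto
  then show ?thesis by (simp add: G_def)
qed

lemma coset_series_row:
  assumes "Im z > 0" "Im w > 0" "k \<ge> 1" "r \<in> bottom_rows"
  shows "((\<lambda>N. A r * (of_nat N ^ k * qexp (coset_act r z + w) ^ N)) has_sum A r * npow_series k (coset_act r z + w)) {1..}"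
  using assms by (intro has_sum_cmult_right has_sum_npow_series(1)) (auto intro: add_pos_pos coset_act_props(3))

lemma coset_series_summable:
  assumes z: "Im z > 0" and w: "Im w > 0" and k: "k \<ge> 1"
    and A: "(\<lambda>r. norm (A r)) summable_on bottom_rows"
  shows "(\<lambda>r. A r * npow_series k (coset_act r z + w)) summable_on bottom_rows"
proof -
  obtain T where "((\<lambda>(r, N). A r * (of_nat N ^ k * qexp (coset_act r z + w) ^ N)) has_sum T) (bottom_rows \<times> {1..})"
    using abs_summable_summable[OF coset_series_abs_summable[OF z w k A]] unfolding summable_on_def by blast
  then have "((\<lambda>r. A r * npow_series k (coset_act r z + w)) has_sum T) bottom_rows"
    by (rule has_sum_SigmaD) (use coset_series_row[OF z w k] in simp)
  then show ?thesis by (rule has_sum_imp_summable)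
qed

text \<open>
  Expanding each summand in powers of the parameter q of w and exchanging the two sums, which is
  allowed because |q(\<gamma>z)| < 1 leaves a product of two convergent series as a majorant.
\<close>

theorem coset_series:
  assumes z: "Im z > 0" and w: "Im w > 0" and k: "k \<ge> 1"
    and A: "(\<lambda>r. norm (A r)) summable_on bottom_rows"
    and S: "((\<lambda>r. A r * npow_series k (coset_act r z + w)) has_sum S) bottom_rows"
  shows "((\<lambda>N. of_nat N ^ k * (\<Sum>\<^sub>\<infinity>r\<in>bottom_rows. A r * qexp (coset_act r z) ^ N) * qexp w ^ N) has_sum S) {1..}"
proof -
  define G where "G = (\<lambda>(r, N). A r * (of_nat N ^ k * qexp (coset_act r z + w) ^ N))"
  have abs: "(\<lambda>x. norm (G x)) summable_on bottom_rows \<times> {1..}"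
    using coset_series_abs_summable[OF z w k A] by (simp add: G_def)
  have "(G has_sum S) (bottom_rows \<times> {1..})"
  proof (rule has_sum_SigmaI[OF _ S abs_summable_summable[OF abs]])
    fix r assume r: "r \<in> bottom_rows"
    then show "((\<lambda>N. G (r, N)) has_sum A r * npow_series k (coset_act r z + w)) {1..}"
      using coset_series_row[OF z w k] by (simp add: G_def)
  qed
  then have "((\<lambda>(N, r). G (r, N)) has_sum S) ({1..} \<times> bottom_rows)"
    by (subst (asm) has_sum_swap) (simp add: case_prod_unfold)
  then show ?thesis
  proof (rule has_sum_SigmaD)
    fix N :: nat
    have "(\<lambda>r. norm (A r * qexp (coset_act r z) ^ N)) summable_on bottom_rows"
      using A
    proof (rule summable_on_comparison_test, goal_cases)
      case (1 r)
      have "norm (qexp (coset_act r z)) ^ N \<le> 1"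
        using norm_qexp_less_1[OF coset_act_props(3)[OF z 1]] by (intro power_le_one) auto
      then show ?case by (simp add: norm_mult norm_power mult_left_le)
    qed auto
    from has_sum_infsum[OF abs_summable_summable[OF this]]
    have "((\<lambda>r. (of_nat N ^ k * qexp w ^ N) * (A r * qexp (coset_act r z) ^ N)) has_sum
            (of_nat N ^ k * qexp w ^ N) * (\<Sum>\<^sub>\<infinity>r\<in>bottom_rows. A r * qexp (coset_act r z) ^ N)) bottom_rows"
      by (rule has_sum_cmult_right)
    then show "((\<lambda>r. case (N, r) of (N, r) \<Rightarrow> G (r, N)) has_sum
        of_nat N ^ k * (\<Sum>\<^sub>\<infinity>r\<in>bottom_rows. A r * qexp (coset_act r z) ^ N) * qexp w ^ N) bottom_rows"
      by (simp add: G_def qexp_add power_mult_distrib mult_ac)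
  qed
qed

definition Poincare :: "nat \<Rightarrow> nat \<Rightarrow> complex \<Rightarrow> complex" where
  "Poincare k N z = (\<Sum>\<^sub>\<infinity>r\<in>bottom_rows. 1 / cocycle r z ^ k * qexp (coset_act r z) ^ N)"

lemma has_sum_from_1_sums:
  fixes f :: "nat \<Rightarrow> complex"
  assumes "(f has_sum S) {1..}"
  shows "(\<lambda>n. f (Suc n)) sums S"
proof -
  have "((\<lambda>n. f (Suc n)) has_sum S) UNIV"
    by (rule has_sum_reindex_bij_witness[of _ "\<lambda>n. n - 1" Suc, THEN iffD2, OF _ _ _ _ _ _ assms]) auto
  then show ?thesis by (rule has_sum_imp_sums)
qed

lemma Poincare_scale:
  "(\<Sum>\<^sub>\<infinity>r\<in>bottom_rows. C / cocycle r z ^ k * qexp (coset_act r z) ^ N) = C * Poincare k N z"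
  unfolding Poincare_def by (subst infsum_cmult_right' [symmetric]) simp

lemma summable_scaled_cocycle:
  assumes "Im z > 0" "p \<ge> 3"
  shows "(\<lambda>r. norm (C / cocycle r z ^ p)) summable_on bottom_rows"
  using summable_on_cmult_right[OF summable_cocycle[OF assms], of "norm C"]
  by (simp add: norm_divide)

text \<open>
  Lipschitz's formula applied to the sum over translations in the unfolded kernel.
\<close>

theorem SL2_kernel_series:
  assumes z: "Im z > 0" and w: "Im w > 0" and k: "Suc k = 2 * p" "p \<ge> 3"
  shows "(\<lambda>n. Lipschitz_const k * of_nat (Suc n) ^ k * Poincare (Suc k) (Suc n) z * qexp w ^ Suc n) sums SL2_kernel (Suc k) z w"
proof -
  have k1: "k \<ge> 1" using k by simp
  have "((\<lambda>g. 1 / kform z w g ^ Suc k) has_sum SL2_kernel (Suc k) z w) SL2"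
    using has_sum_infsum[OF abs_summable_summable[OF summable_SL2_kernel[OF z w k(2)]]] unfolding SL2_kernel_def k(1) .
  then have "((\<lambda>(r, n). 1 / kform z w (shear r n) ^ Suc k) has_sum SL2_kernel (Suc k) z w) (bottom_rows \<times> UNIV)"
    unfolding SL2_unfold .
  then have "((\<lambda>r. Lipschitz_const k / cocycle r z ^ Suc k * npow_series k (coset_act r z + w)) has_sum SL2_kernel (Suc k) z w) bottom_rows"
  proof (rule has_sum_SigmaD)
    fix r assume r: "r \<in> bottom_rows"
    have im: "Im (coset_act r z + w) > 0" using coset_act_props(3)[OF z r] w by simp
    from has_sum_cmult_right[OF Lipschitz[OF im k1], of "1 / cocycle r z ^ Suc k"]
    show "((\<lambda>n. case (r, n) of (r, n) \<Rightarrow> 1 / kform z w (shear r n) ^ Suc k) has_sum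
            Lipschitz_const k / cocycle r z ^ Suc k * npow_series k (coset_act r z + w)) UNIV"
      by (simp add: kform_shear[OF z r] power_mult_distrib del: power_Suc)
  qed
  from coset_series[OF z w k1 summable_scaled_cocycle[OF z] this] k
  have "((\<lambda>N. of_nat N ^ k * (Lipschitz_const k * Poincare (Suc k) N z) * qexp w ^ N) has_sum SL2_kernel (Suc k) z w) {1..}"
    unfolding Poincare_scale by simp
  from has_sum_from_1_sums[OF this] show ?thesis by (simp only: mult_ac)
qed

lemma Lipschitz_const_nonzero: "Lipschitz_const k \<noteq> 0"
  by (simp add: Lipschitz_const_def)

text \<open>
  As a function of its second variable the kernel of weight 10 is a cusp form of weight 10, so all
  its coefficients vanish.
\<close>

theorem Poincare_10_eq_0:
  assumes z: "Im z > 0" and N: "N \<ge> 1"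
  shows "Poincare 10 N z = 0"
proof -
  obtain n where n: "N = Suc n" using N by (cases N) auto
  have "Lipschitz_const 9 * of_nat (Suc n) ^ 9 * Poincare 10 (Suc n) z = 0"
  proof (rule cusp_form_10[where f = "SL2_kernel 10 z" and c = "\<lambda>n. Lipschitz_const 9 * of_nat (Suc n) ^ 9 * Poincare 10 (Suc n) z"])
    show "(\<lambda>n. Lipschitz_const 9 * of_nat (Suc n) ^ 9 * Poincare 10 (Suc n) z * qexp w ^ Suc n) sums SL2_kernel 10 z w" if "Im w > 0" for w
      using SL2_kernel_series[OF z that, of 9 5] by simp
    show "SL2_kernel 10 z (- 1 / w) = w ^ 10 * SL2_kernel 10 z w" if "Im w > 0" for w
      using SL2_kernel_S[OF that] .
  qed
  then show ?thesis using Lipschitz_const_nonzero[of 9] by (simp add: n del: of_nat_Suc)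
qed

text \<open>
  As a function of its second variable the kernel of weight 12 is a multiple of \<Delta>.  This fixes the
  ratio of any two Poincare series of weight 12.
\<close>

theorem Poincare_12:
  assumes z: "Im z > 0"
  shows "N \<ge> 1 \<Longrightarrow> of_nat N ^ 11 * Poincare 12 N z = Poincare 12 1 z * Delta_coeff N"
    "Im w > 0 \<Longrightarrow> SL2_kernel 12 z w = Lipschitz_const 11 * Poincare 12 1 z * Delta w"
proof -
  let ?c = "\<lambda>n. Lipschitz_const 11 * of_nat (Suc n) ^ 11 * Poincare 12 (Suc n) z"
  have s: "(\<lambda>n. ?c n * qexp w ^ Suc n) sums SL2_kernel 12 z w" if "Im w > 0" for w
    using SL2_kernel_series[OF z that, of 11 6] by simp
  note c = cusp_form_12[of ?c, OF s SL2_kernel_S]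
  show "SL2_kernel 12 z w = Lipschitz_const 11 * Poincare 12 1 z * Delta w" if "Im w > 0"
    using c(2)[OF _ _ that] by simp
  assume N: "N \<ge> 1"
  obtain n where n: "N = Suc n" using N by (cases N) auto
  from c(1)[of n] have "Lipschitz_const 11 * (of_nat N ^ 11 * Poincare 12 N z) = Lipschitz_const 11 * (Poincare 12 1 z * Delta_coeff N)"
    by (simp add: n mult.assoc)
  then show "of_nat N ^ 11 * Poincare 12 N z = Poincare 12 1 z * Delta_coeff N"
    using Lipschitz_const_nonzero[of 11] by simp
qed

section \<open>The derivative of the kernel of weight 10\<close>

text \<open>
  Up to the factor -10 this is the z-derivative of a summand of the kernel of weight 10.
\<close>

definition SL2_kernel_deriv_term :: "complex \<Rightarrow> complex \<Rightarrow> mat \<Rightarrow> complex" where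
  "SL2_kernel_deriv_term z w g = (of_int (fst (fst g)) + of_int (fst (snd g)) * w) / kform z w g ^ 11"

lemma summable_SL2_kernel_deriv:
  assumes z: "Im z > 0" and w: "Im w > 0"
  shows "SL2_kernel_deriv_term z w summable_on SL2"
proof -
  obtain \<kappa> :: real where \<kappa>: "\<kappa> > 0"
    "\<And>c d :: int. \<bar>of_int c\<bar> \<le> \<kappa> * norm (of_int c * z + of_int d)"
    using lattice_form_bound[OF z] by metis
  define \<mu> where "\<mu> = 1 + (1 + norm w) / Im w"
  have "(\<lambda>g. (\<kappa> * \<mu> * (1 + norm w)) * norm (1 / kform z w g ^ (2 * 5))) summable_on SL2"
    by (intro summable_on_cmult_right summable_SL2_kernel z w) simp
  then have "(\<lambda>g. norm (SL2_kernel_deriv_term z w g)) summable_on SL2"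
  proof (rule summable_on_comparison_test, goal_cases)
    case (1 g)
    obtain a b c d where g: "g = ((a,b),(c,d))" by (metis surj_pair)
    note B = kform_bound[OF z w 1[unfolded g]]
    define X where "X = kform z w ((a,b),(c,d))"
    have X0: "X \<noteq> 0" using B(1) by (simp add: X_def)
    have a: "\<bar>real_of_int a\<bar> \<le> \<kappa> * (\<mu> * norm X)"
      using order_trans[OF \<kappa>(2)[of a b] mult_left_mono[OF B(3)]] \<kappa>(1) by (simp add: X_def \<mu>_def)
    have c: "\<bar>real_of_int c\<bar> \<le> \<kappa> * (\<mu> * norm X)"
      using order_trans[OF \<kappa>(2)[of c d] mult_left_mono[OF B(2)]] \<kappa>(1) by (simp add: X_def \<mu>_def)
    have "norm (of_int a + of_int c * w) \<le> \<bar>of_int a\<bar> + \<bar>of_int c\<bar> * norm w"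
      by (metis norm_triangle_ineq norm_mult norm_of_int)
    also have "\<dots> \<le> \<kappa> * (\<mu> * norm X) + \<kappa> * (\<mu> * norm X) * norm w"
      by (intro add_mono mult_right_mono a c) auto
    also have "\<dots> = \<kappa> * \<mu> * (1 + norm w) * norm X" by (simp add: algebra_simps)
    finally have "norm (of_int a + of_int c * w) / norm X ^ 11 \<le> \<kappa> * \<mu> * (1 + norm w) * norm X / norm X ^ 11"
      by (intro divide_right_mono) auto
    also have "norm X ^ 11 = norm X * norm X ^ 10" by (simp flip: power_Suc)
    also have "\<kappa> * \<mu> * (1 + norm w) * norm X / (norm X * norm X ^ 10) = \<kappa> * \<mu> * (1 + norm w) * (1 / norm X ^ 10)"
      using X0 by simp
    finally show ?case
      by (simp add: g SL2_kernel_deriv_term_def X_def norm_divide norm_power flip: power_Suc)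
  qed auto
  then show ?thesis by (rule abs_summable_summable)
qed

text \<open>
  Exchanging the two diagonal entries turns the numerator into the automorphy factor of w.  Unfolded
  in this form, the sum is a generating series of Poincare series of weight 10 at w, all of which
  vanish.
\<close>

theorem SL2_kernel_deriv_eq_0:
  assumes z: "Im z > 0" and w: "Im w > 0"
  shows "(SL2_kernel_deriv_term z w has_sum 0) SL2"
proof -
  obtain S where S: "(SL2_kernel_deriv_term z w has_sum S) SL2"
    using summable_SL2_kernel_deriv[OF z w] by (auto simp: summable_on_def)
  let ?F = "\<lambda>((a, b), (c, d)). (of_int c * w + of_int d) / kform w z ((a, b), (c, d)) ^ 11"
  have "(?F has_sum S) SL2"
    by (rule has_sum_reindex_bij_witness[of _ "\<lambda>((a, b), (c, d)). ((d, b), (c, a))" "\<lambda>((a, b), (c, d)). ((d, b), (c, a))",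
          THEN iffD2, OF _ _ _ _ _ _ S])
       (auto simp: SL2_def SL2_kernel_deriv_term_def kform_def algebra_simps)
  then have "((\<lambda>(r, n). ?F (shear r n)) has_sum S) (bottom_rows \<times> UNIV)"
    unfolding SL2_unfold .
  then have "((\<lambda>r. Lipschitz_const 10 / cocycle r w ^ 10 * npow_series 10 (coset_act r w + z)) has_sum S) bottom_rows"
  proof (rule has_sum_SigmaD)
    fix r assume r: "r \<in> bottom_rows"
    have im: "Im (coset_act r w + z) > 0" using coset_act_props(3)[OF w r] z by simp
    have F: "?F (shear r n) = cocycle r w / kform w z (shear r n) ^ 11" for n
      by (simp add: shear_def cocycle_def case_prod_unfold)
    have "cocycle r w / kform w z (shear r n) ^ 11 = 1 / cocycle r w ^ 10 * (1 / (coset_act r w + z + of_int n) ^ Suc 10)" for n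
      using coset_act_props(1)[OF w r] unfolding kform_shear[OF w r]
      by (simp add: power_mult_distrib) (simp add: power_numeral_reduce)
    moreover have "((\<lambda>n. 1 / cocycle r w ^ 10 * (1 / (coset_act r w + z + of_int n) ^ Suc 10)) has_sum
        (1 / cocycle r w ^ 10 * (Lipschitz_const 10 * npow_series 10 (coset_act r w + z)))) UNIV"
      by (intro has_sum_cmult_right Lipschitz im) simp
    ultimately show "((\<lambda>n. case (r, n) of (r, n) \<Rightarrow> ?F (shear r n)) has_sum
            Lipschitz_const 10 / cocycle r w ^ 10 * npow_series 10 (coset_act r w + z)) UNIV"
      by (simp only: F case_prod_conv) simp
  qed
  from coset_series[OF w z _ summable_scaled_cocycle[OF w] this]
  have "((\<lambda>N. of_nat N ^ 10 * (Lipschitz_const 10 * Poincare 10 N w) * qexp z ^ N) has_sum S) {1..}"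
    unfolding Poincare_scale by simp
  moreover have "((\<lambda>N. of_nat N ^ 10 * (Lipschitz_const 10 * Poincare 10 N w) * qexp z ^ N) has_sum 0) {1..}"
    by (rule has_sum_0) (use Poincare_10_eq_0[OF w] in auto)
  ultimately show ?thesis using S has_sum_unique by blast
qed

text \<open>
  The part of the derivative of a Poincare series of weight 10 that arises from differentiating the
  automorphy factor, divided by -10.
\<close>

definition Poincare_deriv :: "nat \<Rightarrow> complex \<Rightarrow> complex" where
  "Poincare_deriv N z = (\<Sum>\<^sub>\<infinity>r\<in>bottom_rows. of_int (fst r) / cocycle r z ^ 11 * qexp (coset_act r z) ^ N)"

lemma Lipschitz_const_10: "Lipschitz_const 10 = Lipschitz_const 9 * (- of_real pi * \<i> / 5)"
  by (simp add: Lipschitz_const_def fact_numeral power_numeral_reduce)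

lemma summable_deriv_cocycle:
  assumes z: "Im z > 0"
  shows "(\<lambda>r. norm (C * of_int (fst r) / cocycle r z ^ 11)) summable_on bottom_rows"
proof -
  obtain \<kappa> :: real where \<kappa>: "\<kappa> > 0"
    "\<And>c d :: int. \<bar>of_int c\<bar> \<le> \<kappa> * norm (of_int c * z + of_int d)"
    using lattice_form_bound[OF z] by metis
  have "(\<lambda>r. (norm C * \<kappa>) * norm (1 / cocycle r z ^ 10)) summable_on bottom_rows"
    by (intro summable_on_cmult_right summable_cocycle z) simp
  then show ?thesis
  proof (rule summable_on_comparison_test, goal_cases)
    case (1 r)
    define x where "x = norm (cocycle r z)"
    have x: "x > 0" using coset_act_props(1)[OF z 1] by (simp add: x_def)
    have "\<bar>real_of_int (fst r)\<bar> \<le> \<kappa> * x"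
      using \<kappa>(2)[of "fst r" "snd r"] by (simp add: x_def cocycle_def case_prod_unfold)
    then have "norm C * \<bar>real_of_int (fst r)\<bar> / x ^ 11 \<le> norm C * (\<kappa> * x) / x ^ 11"
      using x by (intro divide_right_mono mult_left_mono) auto
    also have "\<dots> = norm C * \<kappa> * (1 / x ^ 10)"
      using x by (simp add: power_numeral_reduce)
    finally show ?case by (simp add: x_def norm_mult norm_divide norm_power)
  qed auto
qed

text \<open>
  This expresses that the derivative of P_10,N vanishes.  Unfolding the same sum without exchanging
  the diagonal entries, a + c w = (c X + 1) / j, where X is the form and j = c z + d, splits each
  summand into Lipschitz sums of exponents 10 and 11.  The total is 0 for every w, so each
  coefficient is 0.
\<close>

theorem Poincare_deriv_eq:
  assumes z: "Im z > 0" and N: "N \<ge> 1"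
  shows "Poincare_deriv N z = of_real pi * \<i> / 5 * of_nat N * Poincare 12 N z"
proof -
  let ?A = "\<lambda>r. Lipschitz_const 9 * of_int (fst r) / cocycle r z ^ 11"
  let ?B = "\<lambda>r. Lipschitz_const 10 / cocycle r z ^ 12"
  have A: "(\<lambda>r. norm (?A r)) summable_on bottom_rows" by (rule summable_deriv_cocycle[OF z])
  have B: "(\<lambda>r. norm (?B r)) summable_on bottom_rows" by (rule summable_scaled_cocycle[OF z]) simp
  have sumA: "(\<Sum>\<^sub>\<infinity>r\<in>bottom_rows. ?A r * qexp (coset_act r z) ^ N) = Lipschitz_const 9 * Poincare_deriv N z" for N
    unfolding Poincare_deriv_def by (subst infsum_cmult_right' [symmetric]) (simp add: mult.assoc)
  let ?c = "\<lambda>n. of_nat (Suc n) ^ 9 * (Lipschitz_const 9 * Poincare_deriv (Suc n) z) + of_nat (Suc n) ^ 10 * (Lipschitz_const 10 * Poincare 12 (Suc n) z)"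
  have series: "(\<lambda>n. ?c n * qexp w ^ Suc n) sums 0" if w: "Im w > 0" for w
  proof -
    obtain S T where ST: "((\<lambda>r. ?A r * npow_series 9 (coset_act r z + w)) has_sum S) bottom_rows"
        "((\<lambda>r. ?B r * npow_series 10 (coset_act r z + w)) has_sum T) bottom_rows"
      using coset_series_summable[OF z w _ A, of 9] coset_series_summable[OF z w _ B, of 10]
      by (auto simp: summable_on_def)
    have "((\<lambda>(r, n). SL2_kernel_deriv_term z w (shear r n)) has_sum 0) (bottom_rows \<times> UNIV)"
      using SL2_kernel_deriv_eq_0[OF z w] unfolding SL2_unfold .
    then have "((\<lambda>r. ?A r * npow_series 9 (coset_act r z + w) + ?B r * npow_series 10 (coset_act r z + w)) has_sum 0) bottom_rows"
    proof (rule has_sum_SigmaD)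
      fix r assume r: "r \<in> bottom_rows"
      have im: "Im (coset_act r z + w) > 0" using coset_act_props(3)[OF z r] w by simp
      let ?j = "cocycle r z"
      have j: "?j \<noteq> 0" by (rule coset_act_props(1)[OF z r])
      have term_eq: "SL2_kernel_deriv_term z w (shear r n) = of_int (fst r) / ?j ^ 11 * (1 / (coset_act r z + w + of_int n) ^ Suc 9)
           + 1 / ?j ^ 12 * (1 / (coset_act r z + w + of_int n) ^ Suc 10)" for n
      proof -
        define a b c d where abcd: "a = fst (top_row r) + n * fst r" "b = snd (top_row r) + n * snd r" "c = fst r" "d = snd r"
        have g: "shear r n = ((a, b), (c, d))" by (simp add: shear_def abcd)
        have "fst (top_row r) * snd r - snd (top_row r) * fst r = 1"
          using top_row[of "fst r" "snd r"] r by simp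
        then have "a * d - b * c = 1" by (simp add: abcd algebra_simps)
        then have det: "of_int a * of_int d - of_int b * of_int c = (1 :: complex)" by (metis of_int_1 of_int_diff of_int_mult)
        define Y where "Y = coset_act r z + w + of_int n"
        have Y0: "Y \<noteq> 0" using im by (auto simp: Y_def complex_eq_iff)
        have X: "kform z w (shear r n) = ?j * Y" unfolding Y_def by (rule kform_shear[OF z r])
        have jd: "?j = of_int c * z + of_int d" by (simp add: cocycle_def abcd case_prod_unfold)
        have "?j * (of_int a + of_int c * w) = of_int c * kform z w (shear r n) + (of_int a * of_int d - of_int b * of_int c)"
          unfolding g jd by (simp add: kform_def algebra_simps)
        then have "of_int a + of_int c * w = (of_int c * (?j * Y) + 1) / ?j"
          using j by (simp add: det X field_simps)
        then have "SL2_kernel_deriv_term z w (shear r n) = (of_int c * (?j * Y) + 1) / ?j / (?j * Y) ^ 11"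
          unfolding SL2_kernel_deriv_term_def X by (simp add: g)
        also have "\<dots> = of_int c / ?j ^ 11 * (1 / Y ^ Suc 9) + 1 / ?j ^ 12 * (1 / Y ^ Suc 10)"
        proof -
          have e: "Y ^ Suc 10 = Y ^ 10 * Y" "?j ^ 12 = ?j ^ 11 * ?j" "Y ^ Suc 9 = Y ^ 10" "Y ^ 11 = Y ^ 10 * Y"
            by (simp_all add: power_numeral_reduce)
          show ?thesis unfolding power_mult_distrib e using j Y0 by (simp add: divide_simps)
        qed
        finally show ?thesis by (simp add: abcd Y_def)
      qed
      have "((\<lambda>n. of_int (fst r) / ?j ^ 11 * (1 / (coset_act r z + w + of_int n) ^ Suc 9)
           + 1 / ?j ^ 12 * (1 / (coset_act r z + w + of_int n) ^ Suc 10)) has_sum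
           (of_int (fst r) / ?j ^ 11 * (Lipschitz_const 9 * npow_series 9 (coset_act r z + w)) + 1 / ?j ^ 12 * (Lipschitz_const 10 * npow_series 10 (coset_act r z + w)))) UNIV"
        by (intro has_sum_add has_sum_cmult_right Lipschitz im) auto
      then show "((\<lambda>n. case (r, n) of (r, n) \<Rightarrow> SL2_kernel_deriv_term z w (shear r n)) has_sum
         ?A r * npow_series 9 (coset_act r z + w) + ?B r * npow_series 10 (coset_act r z + w)) UNIV"
        by (simp only: term_eq case_prod_conv) (simp add: mult_ac)
    qed
    moreover have "((\<lambda>r. ?A r * npow_series 9 (coset_act r z + w) + ?B r * npow_series 10 (coset_act r z + w)) has_sum (S + T)) bottom_rows"
      by (intro has_sum_add ST)
    ultimately have ST0: "S + T = 0" using has_sum_unique by blast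
    have "((\<lambda>N. of_nat N ^ 9 * (Lipschitz_const 9 * Poincare_deriv N z) * qexp w ^ N) has_sum S) {1..}"
      using coset_series[OF z w _ A ST(1)] unfolding sumA by simp
    moreover have "((\<lambda>N. of_nat N ^ 10 * (Lipschitz_const 10 * Poincare 12 N z) * qexp w ^ N) has_sum T) {1..}"
      using coset_series[OF z w _ B ST(2)] unfolding Poincare_scale by simp
    ultimately have "((\<lambda>N. of_nat N ^ 9 * (Lipschitz_const 9 * Poincare_deriv N z) * qexp w ^ N + of_nat N ^ 10 * (Lipschitz_const 10 * Poincare 12 N z) * qexp w ^ N) has_sum (S + T)) {1..}"
      by (rule has_sum_add)
    from has_sum_from_1_sums[OF this] show ?thesis unfolding ST0 distrib_right[symmetric] .
  qed
  obtain n where n: "N = Suc n" using N by (cases N) auto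
  \<comment> \<open>A series in q that vanishes identically has zero coefficients: its sum is a cusp form of weight 10.\<close>
  have "?c n = 0" by (rule cusp_form_10[where f = "\<lambda>_. 0"]) (use series in auto)
  then have "of_nat N ^ 9 * Lipschitz_const 9 * (Poincare_deriv N z - of_real pi * \<i> / 5 * of_nat N * Poincare 12 N z) = 0"
    unfolding n[symmetric] Lipschitz_const_10 by (simp add: algebra_simps power_numeral_reduce)
  then show ?thesis using N Lipschitz_const_nonzero[of 9] by simp
qed

section \<open>A Poincare series of weight 12 that does not vanish\<close>

lemma sum_inverse_sixth:
  obtains Z :: real where "((\<lambda>n::nat. 1 / real n ^ 6) has_sum Z) {1..}" "Z \<ge> 0" "Z \<le> 1.021"
proof -
  \<comment> \<open>A majorant of 1 / n^6 that is exact for n = 1 and n = 2 and equals 1 / (81 n^2) afterwards.\<close>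
  let ?g = "\<lambda>n::nat. (if n = 1 then 80 / 81 else 0) + (if n = 2 then 1 / 64 - 1 / 324 else 0) + 1 / 81 * (1 / real n ^ 2)"
  have f: "((\<lambda>n::nat. if n = k then c else 0) has_sum c) {1..}" if "k \<ge> 1" for k and c :: real
    by (rule has_sum_finite_neutralI[of "{k}"]) (use that in auto)
  have g: "(?g has_sum (80 / 81 + (1 / 64 - 1 / 324) + 1 / 81 * (pi ^ 2 / 6))) {1..}"
    by (intro has_sum_add has_sum_cmult_right has_sum_inverse_squares_real f) auto
  have le: "1 / real n ^ 6 \<le> ?g n" if "n \<in> {1..}" for n
  proof (cases "n \<ge> 3")
    case True
    have "(3 :: real) ^ 4 \<le> real n ^ 4" using True by (intro power_mono) auto
    then have "81 * real n ^ 2 \<le> real n ^ 4 * real n ^ 2" by (intro mult_right_mono) auto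
    then have "81 * real n ^ 2 \<le> real n ^ 6" by (simp flip: power_add)
    then have "1 / real n ^ 6 \<le> 1 / (81 * real n ^ 2)" using True by (intro divide_left_mono) auto
    then show ?thesis using True by simp
  next
    case False
    then have "n = 1 \<or> n = 2" using that by auto
    then show ?thesis by auto
  qed
  have "(\<lambda>n::nat. 1 / real n ^ 6) summable_on {1..}"
    by (rule summable_on_comparison_test[OF has_sum_imp_summable[OF g]]) (use le in auto)
  then obtain Z where Z: "((\<lambda>n::nat. 1 / real n ^ 6) has_sum Z) {1..}" by (auto simp: summable_on_def)
  have "Z \<le> 80 / 81 + (1 / 64 - 1 / 324) + 1 / 81 * (pi ^ 2 / 6)"
    by (rule has_sum_mono[OF Z g]) (use le in auto)
  moreover have "pi ^ 2 \<le> 3.15 ^ 2" using pi_approx by (intro power_mono) auto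
  ultimately have "Z \<le> 1.021" by (simp add: power2_eq_square)
  moreover have "Z \<ge> 0" by (rule has_sum_nonneg[OF Z]) auto
  ultimately show ?thesis using that Z by blast
qed

lemma exp_pi_le: "exp pi \<le> (24 :: real)"
proof -
  have "exp (0.15 :: real) \<le> 1 + 0.15 + 0.15 ^ 2" by (rule exp_bound) auto
  then have 1: "exp (0.15 :: real) \<le> 1.1725" by (simp add: power2_eq_square)
  have "exp 1 \<le> (2.7183 :: real)" using abs_le_D1[OF e_approx_32] by simp
  then have "exp (3 :: real) \<le> 2.7183 ^ 3"
    using power_mono[of "exp 1" "2.7183 :: real" 3] exp_of_nat_mult[of 3 "1 :: real"] by simp
  then have 2: "exp (3 :: real) \<le> 20.0864" by (simp add: power3_eq_cube)
  have "exp pi \<le> exp (3 + 0.15 :: real)" using pi_approx by simp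
  also have "\<dots> = exp 3 * exp 0.15" by (rule exp_add)
  also have "\<dots> \<le> 20.0864 * 1.1725" by (intro mult_mono 1 2) auto
  finally show ?thesis by simp
qed

text \<open>
  At z = i the bottom rows (0,\<plusminus>1) and (\<plusminus>1,0) contribute exp (-2 \<pi>) each.  For all other rows
  c and d are both nonzero.  The four rows with |c| = |d| = 1 contribute exp (-\<pi>) / 64 each in absolute
  value, and the remaining ones at most (c^2 + d^2)^(-6) \<le> (2 |c d|)^(-6).  With x = exp (-\<pi>) and
  Z = \<zeta>(6), vanishing would force 4 x^2 \<le> (Z^2 - 1 + x) / 16, which fails for x \<ge> 1/24 and
  Z \<le> 1.021.
\<close>

theorem Poincare_12_1_nonzero: "Poincare 12 1 \<i> \<noteq> 0"
proof
  assume zero: "Poincare 12 1 \<i> = 0"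
  define x where "x = exp (- pi)"
  define U :: "(int \<times> int) set" where "U = {(0, 1), (0, -1), (1, 0), (-1, 0)}"
  define V where "V = bottom_rows - U"
  define t where "t = (\<lambda>r. 1 / cocycle r \<i> ^ 12 * qexp (coset_act r \<i>))"
  have U: "U \<subseteq> bottom_rows" by (auto simp: U_def bottom_rows_def)
  have i12: "\<i> ^ 12 = (1 :: complex)" "(- \<i>) ^ 12 = (1 :: complex)" by (simp_all add: power_numeral_reduce)
  have tU: "t r = qexp \<i>" if "r \<in> U" for r
  proof -
    have rb: "(fst r, snd r) \<in> bottom_rows" using that U by auto
    define a b where "a = fst (top_row r)" "b = snd (top_row r)"
    have det: "a * snd r - b * fst r = 1" using top_row[OF rb] by (simp add: a_b_def)
    have act: "coset_act r \<i> = (of_int a * \<i> + of_int b) / cocycle r \<i>"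
      by (simp add: coset_act_def cocycle_def a_b_def case_prod_unfold)
    have "\<exists>n::int. coset_act r \<i> = \<i> + of_int n"
      using that unfolding U_def
    proof (elim insertE emptyE)
      assume r: "r = (0, 1)"
      then have "a = 1" using det by simp
      then show ?thesis by (intro exI[of _ b]) (simp add: act[unfolded r] r cocycle_def)
    next
      assume r: "r = (0, -1)"
      then have "a = -1" using det by simp
      then show ?thesis by (intro exI[of _ "-b"]) (simp add: act[unfolded r] r cocycle_def)
    next
      assume r: "r = (1, 0)"
      then have "b = -1" using det by simp
      then show ?thesis by (intro exI[of _ a]) (simp add: act[unfolded r] r cocycle_def field_simps)
    next
      assume r: "r = (-1, 0)"
      then have "b = 1" using det by simp
      then show ?thesis by (intro exI[of _ "-a"]) (simp add: act[unfolded r] r cocycle_def field_simps)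
    qed
    then have "qexp (coset_act r \<i>) = qexp \<i>" using qexp_add_int by metis
    moreover have "cocycle r \<i> ^ 12 = 1"
      using that i12 by (auto simp: U_def cocycle_def)
    ultimately show ?thesis by (simp add: t_def)
  qed
  have abs: "(\<lambda>r. norm (t r)) summable_on bottom_rows"
  proof (rule summable_on_comparison_test[OF summable_cocycle[of \<i> 12]], goal_cases)
    case (3 r)
    have "norm (qexp (coset_act r \<i>)) \<le> 1"
      using norm_qexp_less_1[OF coset_act_props(3)[OF _ 3, of \<i>]] by simp
    then show ?case unfolding t_def norm_mult by (intro mult_left_le) auto
  qed auto
  have "(t has_sum 0) bottom_rows"
    using has_sum_infsum[OF abs_summable_summable[OF abs]] zero by (simp add: Poincare_def t_def)
  moreover have "(t has_sum (\<Sum>r\<in>U. t r)) U" by (rule has_sum_finite) (simp add: U_def)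
  ultimately have "(t has_sum (0 - (\<Sum>r\<in>U. t r))) V"
    unfolding V_def using U by (rule has_sum_Diff)
  moreover have "(\<Sum>r\<in>U. t r) = 4 * qexp \<i>"
  proof -
    have "card U = 4" by (simp add: U_def)
    then show ?thesis using tU by simp
  qed
  ultimately have tV: "(t has_sum (- 4 * qexp \<i>)) V" by simp
  obtain Z where Z: "((\<lambda>n::nat. 1 / real n ^ 6) has_sum Z) {1..}" "Z \<ge> 0" "Z \<le> 1.021"
    using sum_inverse_sixth by blast
  let ?q = "\<lambda>c::int. 1 / real (nat \<bar>c\<bar>) ^ 6"
  have q: "(?q has_sum (Z + Z)) (- {0})" by (rule has_sum_nonzero_ints[OF Z(1)])
  define D :: "(int \<times> int) set" where "D = {(1, 1), (1, -1), (-1, 1), (-1, -1)}"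
  \<comment> \<open>The majorant (2 |c d|)^(-6), lowered on D to x / 64, the exact absolute value there.\<close>
  let ?h = "\<lambda>r. 1 / 64 * (case r of (c, d) \<Rightarrow> ?q c * ?q d) + (if r \<in> D then - (1 - x) / 64 else 0)"
  have "((\<lambda>(c, d). ?q c * ?q d) has_sum ((Z + Z) * (Z + Z))) ((- {0}) \<times> (- {0}))"
  proof (rule has_sum_SigmaI)
    show "((\<lambda>d. case (c, d) of (c, d) \<Rightarrow> ?q c * ?q d) has_sum ?q c * (Z + Z)) (- {0})" for c
      using has_sum_cmult_right[OF q, of "?q c"] by simp
    show "((\<lambda>c. ?q c * (Z + Z)) has_sum ((Z + Z) * (Z + Z))) (- {0})"
      by (rule has_sum_cmult_left[OF q])
    show "(\<lambda>(c, d). ?q c * ?q d) summable_on ((- {0}) \<times> (- {0}))"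
      by (rule summable_on_product_nonneg) (use has_sum_imp_summable[OF q] in auto)
  qed
  moreover have "((\<lambda>r. if r \<in> D then - (1 - x) / 64 else 0) has_sum (4 * (- (1 - x) / 64))) ((- {0}) \<times> (- {0}))"
  proof -
    have "card D = 4" by (simp add: D_def)
    then show ?thesis
      by (intro has_sum_finite_neutralI[of D]) (auto simp: D_def)
  qed
  ultimately have h: "(?h has_sum (1 / 64 * ((Z + Z) * (Z + Z)) + 4 * (- (1 - x) / 64))) ((- {0}) \<times> (- {0}))"
    by (intro has_sum_add has_sum_cmult_right)
  have VC: "V \<subseteq> (- {0}) \<times> (- {0})"
  proof
    fix r assume r: "r \<in> V"
    obtain c d where cd: "r = (c, d)" by force
    have "coprime c d" "r \<notin> U" using r by (auto simp: V_def bottom_rows_def cd)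
    moreover have "c \<noteq> 0"
    proof
      assume "c = 0"
      then have "\<bar>d\<bar> = 1" using \<open>coprime c d\<close> by simp
      then show False using \<open>r \<notin> U\<close> \<open>c = 0\<close> by (auto simp: U_def cd)
    qed
    moreover have "d \<noteq> 0"
    proof
      assume "d = 0"
      then have "\<bar>c\<bar> = 1" using \<open>coprime c d\<close> by simp
      then show False using \<open>r \<notin> U\<close> \<open>d = 0\<close> by (auto simp: U_def cd)
    qed
    ultimately show "r \<in> (- {0}) \<times> (- {0})" by (simp add: cd)
  qed
  have xle: "x \<le> 1" by (simp add: x_def)
  have hnn: "?h r \<ge> 0" if "r \<in> (- {0}) \<times> (- {0})" for r
  proof (cases "r \<in> D")
    case True
    then have "?h r = x / 64" by (auto simp: D_def field_simps)
    moreover have "x / 64 \<ge> 0" by (simp add: x_def)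
    ultimately show ?thesis by (simp only:)
  qed (auto simp: case_prod_unfold)
  have th: "norm (t r) \<le> ?h r" if r: "r \<in> V" for r
  proof -
    obtain c d where cd: "r = (c, d)" by force
    have nz: "c \<noteq> 0" "d \<noteq> 0" using VC r cd by auto
    have rb: "r \<in> bottom_rows" using r by (simp add: V_def)
    define n where "n = real_of_int c ^ 2 + real_of_int d ^ 2"
    have n: "norm (cocycle r \<i>) ^ 2 = n" by (simp add: cd cocycle_def cmod_power2 n_def)
    have n12: "norm (cocycle r \<i>) ^ 12 = n ^ 6" by (simp add: n[symmetric] flip: power_mult)
    have "Im (coset_act r \<i>) = 1 / n" using coset_act_props(2)[OF _ rb, of \<i>] n by simp
    then have t: "norm (t r) = 1 / n ^ 6 * exp (- 2 * pi / n)"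
      by (simp add: t_def norm_mult norm_divide norm_power n12 norm_qexp)
    show ?thesis
    proof (cases "r \<in> D")
      case True
      then have "n = 2" by (auto simp: D_def cd n_def)
      then have "norm (t r) = x / 64" by (simp add: t x_def)
      moreover have "?h r = x / 64" using True by (auto simp: D_def field_simps)
      ultimately show ?thesis by (simp only:)
    next
      case False
      define y where "y = \<bar>real_of_int c\<bar> * \<bar>real_of_int d\<bar>"
      have y: "y > 0" using nz by (simp add: y_def)
      have "2 * y \<le> n"
        using sum_squares_bound[of "\<bar>real_of_int c\<bar>" "\<bar>real_of_int d\<bar>"] by (simp add: y_def n_def)
      then have "(2 * y) ^ 6 \<le> n ^ 6" using y by (intro power_mono) auto
      then have "1 / n ^ 6 \<le> 1 / (2 * y) ^ 6" using y \<open>2 * y \<le> n\<close> by (intro divide_left_mono mult_pos_pos zero_less_power) auto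
      moreover have "exp (- 2 * pi / n) \<le> 1" using y \<open>2 * y \<le> n\<close> by simp
      moreover have "1 / n ^ 6 \<ge> 0" using y \<open>2 * y \<le> n\<close> by simp
      ultimately have "norm (t r) \<le> 1 / (2 * y) ^ 6 * 1" unfolding t by (intro mult_mono) auto
      also have "\<dots> = ?h r" using False by (simp add: cd y_def power_mult_distrib)
      finally show ?thesis .
    qed
  qed
  have hV: "?h summable_on V"
    using has_sum_imp_summable[OF h] VC by (rule summable_on_subset_banach)
  have "norm (- 4 * qexp \<i>) \<le> infsum (\<lambda>r. norm (t r)) V"
    using norm_infsum_bound[of t V] infsumI[OF tV] summable_on_subset_banach[OF abs, of V] by (simp add: V_def)
  also have "\<dots> \<le> infsum ?h V"
    by (rule infsum_mono[OF summable_on_subset_banach[OF abs] hV th]) (auto simp: V_def)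
  also have "\<dots> \<le> infsum ?h ((- {0}) \<times> (- {0}))"
    by (rule infsum_mono2[OF hV has_sum_imp_summable[OF h] VC]) (use hnn in blast)
  also have "\<dots> = 1 / 64 * ((Z + Z) * (Z + Z)) + 4 * (- (1 - x) / 64)"
    by (rule infsumI[OF h])
  also have "norm (- 4 * qexp \<i>) = 4 * x ^ 2"
    by (simp add: norm_mult norm_qexp x_def power2_eq_square flip: exp_add)
  finally have main: "64 * x ^ 2 \<le> Z ^ 2 - 1 + x" by (simp add: power2_eq_square field_simps)
  have "x * exp pi = 1" by (simp add: x_def flip: exp_add)
  moreover have "x > 0" by (simp add: x_def)
  ultimately have "1 \<le> x * 24" using exp_pi_le mult_left_mono[of "exp pi" 24 x] by simp
  then have x: "x \<ge> 1 / 24" by simp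
  have "1 / 24 * (64 * (1 / 24) - 1) \<le> x * (64 * x - 1)" using x by (intro mult_mono) auto
  moreover have "Z ^ 2 \<le> 1.021 ^ 2" using Z by (intro power_mono) auto
  ultimately show False using main by (simp add: power2_eq_square algebra_simps)
qed

section \<open>Modularity of the discriminant and the relation between Poincare series\<close>

text \<open>
  The kernel of weight 12 at z = i is a nonzero multiple of \<Delta>(w), and it is modular for trivial
  reasons.
\<close>

theorem Delta_modular:
  fixes a b c d :: int
  assumes det: "a * d - b * c = 1" and z: "Im z > 0"
  shows "Delta ((of_int a * z + of_int b) / (of_int c * z + of_int d)) = (of_int c * z + of_int d) ^ 12 * Delta z"
proof -
  let ?C = "Lipschitz_const 11 * Poincare 12 1 \<i>"
  have C: "?C \<noteq> 0" using Lipschitz_const_nonzero Poincare_12_1_nonzero by simp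
  have "?C * Delta ((of_int a * z + of_int b) / (of_int c * z + of_int d)) = ?C * ((of_int c * z + of_int d) ^ 12 * Delta z)"
  proof -
    have i: "Im \<i> > 0" by simp
    show ?thesis
      using SL2_kernel_modular[OF det z, of 12 \<i>]
      unfolding Poincare_12(2)[OF i z] Poincare_12(2)[OF i Im_moebius_pos(3)[OF z det]] by (simp only: mult_ac)
  qed
  then show ?thesis using C by (simp only: mult_cancel_left) simp
qed

text \<open>
  The logarithmic derivative of the transformation law of \<Delta>.
\<close>

theorem E2_modular:
  fixes a b c d :: int
  assumes det: "a * d - b * c = 1" and z: "Im z > 0"
  defines "j \<equiv> of_int c * z + of_int d"
  shows "E2 ((of_int a * z + of_int b) / j) = j ^ 2 * E2 z + 6 / (of_real pi * \<i>) * of_int c * j"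
proof -
  define \<gamma> where "\<gamma> = (\<lambda>z :: complex. (of_int a * z + of_int b) / (of_int c * z + of_int d))"
  have j: "j \<noteq> 0" using Im_moebius_pos(1)[OF z det] by (simp add: j_def)
  have im: "Im (\<gamma> z) > 0" using Im_moebius_pos(3)[OF z det] by (simp add: \<gamma>_def)
  have det': "of_int a * of_int d - of_int b * of_int c = (1 :: complex)"
    using det by (metis of_int_1 of_int_diff of_int_mult)
  have "(\<gamma> has_field_derivative (of_int a * j - (of_int a * z + of_int b) * of_int c) / (j * j)) (at z)"
    unfolding \<gamma>_def j_def using j by (auto intro!: derivative_eq_intros simp: j_def)
  also have "of_int a * j - (of_int a * z + of_int b) * of_int c = 1"
    using det' by (simp add: j_def algebra_simps)
  finally have d\<gamma>: "(\<gamma> has_field_derivative 1 / (j * j)) (at z)" .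
  have 1: "((\<lambda>z. Delta (\<gamma> z)) has_field_derivative 2 * of_real pi * \<i> * E2 (\<gamma> z) * Delta (\<gamma> z) * (1 / (j * j))) (at z)"
    by (rule DERIV_chain2[where f = Delta and g = \<gamma>, OF has_field_derivative_Delta[OF im] d\<gamma>])
  have "((\<lambda>z. (of_int c * z + of_int d) ^ 12) has_field_derivative 12 * of_int c * j ^ 11) (at z)"
    unfolding j_def by (auto intro!: derivative_eq_intros)
  from DERIV_mult[OF this has_field_derivative_Delta[OF z]]
  have "((\<lambda>z. (of_int c * z + of_int d) ^ 12 * Delta z) has_field_derivative
       12 * of_int c * j ^ 11 * Delta z + 2 * of_real pi * \<i> * E2 z * Delta z * j ^ 12) (at z)"
    by (simp only: j_def)
  then have "((\<lambda>z. Delta (\<gamma> z)) has_field_derivative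
       12 * of_int c * j ^ 11 * Delta z + 2 * of_real pi * \<i> * E2 z * Delta z * j ^ 12) (at z)"
  proof (rule has_field_derivative_transform_within_open[where S = "{z. Im z > 0}"])
    show "open {z. Im z > 0}" by (rule open_halfspace_Im_gt)
  qed (use z Delta_modular[OF det] in \<open>auto simp: \<gamma>_def\<close>)
  with 1 have "12 * of_int c * j ^ 11 * Delta z + 2 * of_real pi * \<i> * E2 z * Delta z * j ^ 12 =
      2 * of_real pi * \<i> * E2 (\<gamma> z) * Delta (\<gamma> z) * (1 / (j * j))"
    using DERIV_unique by blast
  also have "Delta (\<gamma> z) = j ^ 12 * Delta z"
    using Delta_modular[OF det z] by (simp add: \<gamma>_def j_def)
  finally have D: "2 * of_real pi * \<i> * E2 (\<gamma> z) * (j ^ 12 * Delta z) * (1 / (j * j)) =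
       12 * of_int c * j ^ 11 * Delta z + 2 * of_real pi * \<i> * E2 z * Delta z * j ^ 12" by (rule sym)
  have p: "j ^ 11 = j ^ 10 * j" "j ^ 12 = j ^ 10 * j ^ 2"
    by (simp_all flip: power_add power_Suc2)
  have "j ^ 12 * (1 / (j * j)) = j ^ 10" using j by (simp add: p power2_eq_square)
  then have "(j ^ 10 * Delta z) * (2 * of_real pi * \<i> * E2 (\<gamma> z)) =
      2 * of_real pi * \<i> * E2 (\<gamma> z) * (j ^ 12 * Delta z) * (1 / (j * j))"
    by (metis mult.assoc mult.commute)
  also note D
  also have "12 * of_int c * j ^ 11 * Delta z + 2 * of_real pi * \<i> * E2 z * Delta z * j ^ 12 =
      (j ^ 10 * Delta z) * (12 * of_int c * j + 2 * of_real pi * \<i> * E2 z * j ^ 2)"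
    unfolding p by (simp only: algebra_simps)
  finally have "(j ^ 10 * Delta z) * (2 * of_real pi * \<i> * E2 (\<gamma> z)) =
      (j ^ 10 * Delta z) * (12 * of_int c * j + 2 * of_real pi * \<i> * E2 z * j ^ 2)" .
  then have A: "2 * of_real pi * \<i> * E2 (\<gamma> z) = 12 * of_int c * j + 2 * of_real pi * \<i> * E2 z * j ^ 2"
    using j Delta_nonzero[of z] by simp
  have B: "2 * of_real pi * \<i> * (6 / (of_real pi * \<i>) * of_int c * j) = 12 * of_int c * j" by simp
  have "2 * of_real pi * \<i> * E2 (\<gamma> z) = 2 * of_real pi * \<i> * (j ^ 2 * E2 z + 6 / (of_real pi * \<i>) * of_int c * j)"
    unfolding distrib_left A B by (simp add: mult.commute)
  then show ?thesis by (simp add: \<gamma>_def j_def)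
qed

corollary E2_coset_act:
  assumes z: "Im z > 0" and r: "r \<in> bottom_rows"
  shows "E2 (coset_act r z) = cocycle r z ^ 2 * E2 z + 6 / (of_real pi * \<i>) * of_int (fst r) * cocycle r z"
proof -
  obtain c d where cd: "r = (c, d)" by force
  show ?thesis
    using E2_modular[OF top_row[of c d] z] r by (simp add: cd coset_act_def cocycle_def case_prod_unfold)
qed

text \<open>
  Sum j^(-12) E_2(\<gamma>z) exp (2 \<pi> i m \<gamma>z) over the bottom rows.  Transforming E_2(\<gamma>z) to E_2(z) gives
  E_2(z) P_10,m, which is 0, plus a multiple of the sum in Poincare_deriv_eq; the total is (6/5) m P_12,m.
  Expanding E_2(\<gamma>z) in q(\<gamma>z) gives P_12,m - 24 \<Sum> \<sigma>(n) P_12,n+m.  The double series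
  converges absolutely because exp (-t) \<le> 256 / t^4 for t > 0: with Im \<gamma>z = Im z / |j|^2 this costs
  only |j|^8, and the majorant \<Sum> n^(-2) |j|^(-4) converges.
\<close>

theorem Poincare_12_relation:
  assumes z: "Im z > 0" and m: "m \<ge> 1"
  shows "(\<lambda>n. norm (of_nat (divisor_sigma n) * Poincare 12 (n + m) z)) summable_on {1..}"
    and "20 * (\<Sum>\<^sub>\<infinity>n\<in>{1..}. of_nat (divisor_sigma n) * Poincare 12 (n + m) z) = (5 / 6 - of_nat m) * Poincare 12 m z"
proof -
  define G where "G = (\<lambda>(r, n). 1 / cocycle r z ^ 12 * (of_nat (divisor_sigma n) * qexp (coset_act r z) ^ (n + m)))"
  have "(\<lambda>x. 256 / Im z ^ 4 * (case x of (r, n) \<Rightarrow> norm (1 / cocycle r z ^ 4) * (1 / real n ^ 2))) summable_on bottom_rows \<times> {1..}"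
    by (intro summable_on_cmult_right summable_on_product_nonneg summable_cocycle z
        has_sum_imp_summable[OF has_sum_inverse_squares_real]) auto
  then have abs: "(\<lambda>x. norm (G x)) summable_on bottom_rows \<times> {1..}"
  proof (rule summable_on_comparison_test, goal_cases)
    case (1 x)
    then obtain r n where x: "x = (r, n)" "r \<in> bottom_rows" "n \<ge> 1" by auto
    define j y where "j = norm (cocycle r z)" "y = Im z / j ^ 2"
    have j: "j > 0" using coset_act_props(1)[OF z x(2)] by (simp add: j_y_def)
    have y: "y > 0" using j z by (simp add: j_y_def)
    have Im: "Im (coset_act r z) = y" using coset_act_props(2)[OF z x(2)] by (simp add: j_y_def)
    have ny: "real n * y > 0" using x y by simp
    have "(real n * y) ^ 4 / 256 = (real n * y / 4) ^ 4" by (simp add: power_divide)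
    also have "\<dots> \<le> exp (real n * y / 4) ^ 4"
    proof (rule power_mono)
      show "real n * y / 4 \<le> exp (real n * y / 4)"
        using exp_ge_add_one_self[of "real n * y / 4"] by linarith
    qed (use ny in simp)
    also have "\<dots> = exp (real n * y)" by (simp flip: exp_of_nat_mult)
    also have "\<dots> \<le> exp (2 * pi * (real n * y))"
    proof -
      have "1 * (real n * y) \<le> 2 * pi * (real n * y)" using ny pi_approx by (intro mult_right_mono) auto
      then show ?thesis by simp
    qed
    finally have "1 / exp (2 * pi * (real n * y)) \<le> 1 / ((real n * y) ^ 4 / 256)"
      by (rule divide_left_mono) (use zero_less_power[OF ny, of 4] in auto)
    then have e: "exp (- (2 * pi * (real n * y))) \<le> 256 / (real n * y) ^ 4"
      by (simp only: exp_minus inverse_eq_divide divide_divide_eq_right mult_1)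
    have "norm (qexp (coset_act r z)) ^ (n + m) \<le> norm (qexp (coset_act r z)) ^ n"
      using norm_qexp_less_1[of "coset_act r z"] y Im by (intro power_decreasing) auto
    also have "\<dots> = exp (- (2 * pi * (real n * y)))"
      by (simp add: norm_qexp Im mult_ac flip: exp_of_nat_mult)
    also note e
    finally have e': "norm (qexp (coset_act r z)) ^ (n + m) \<le> 256 / (real n * y) ^ 4" .
    have s: "real (divisor_sigma n) \<le> real n ^ 2" using divisor_sigma_le[of n] by (metis of_nat_le_iff of_nat_power)
    have "norm (G x) = 1 / j ^ 12 * (real (divisor_sigma n) * norm (qexp (coset_act r z)) ^ (n + m))"
      by (simp add: x G_def norm_mult norm_divide norm_power j_y_def)
    also have "\<dots> \<le> 1 / j ^ 12 * (real n ^ 2 * (256 / (real n * y) ^ 4))"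
      using s e' j by (intro mult_left_mono mult_mono) auto
    also have "\<dots> = 256 / Im z ^ 4 * (1 / j ^ 4 * (1 / real n ^ 2))"
    proof -
      have "(real n * y) ^ 4 = real n ^ 2 * real n ^ 2 * Im z ^ 4 / j ^ 8"
        unfolding j_y_def by (simp add: power_mult_distrib power_divide flip: power_mult power_add)
      moreover have "j ^ 12 = j ^ 8 * j ^ 4" by (simp flip: power_add)
      moreover have "1 / (a * b) * (c * (256 / (c * c * d / a))) = 256 / d * (1 / b * (1 / c))"
        if "a \<noteq> 0" "b \<noteq> 0" "c \<noteq> 0" "d \<noteq> 0" for a b c d :: real
        using that by (simp add: divide_simps)
      moreover have "j ^ 8 \<noteq> 0" "j ^ 4 \<noteq> 0" "real n ^ 2 \<noteq> 0" "Im z ^ 4 \<noteq> 0" using j x z by auto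
      ultimately show ?thesis by presburger
    qed
    finally show ?case by (simp add: x norm_divide norm_power j_y_def)
  qed auto
  have abs': "(\<lambda>(n, r). norm (G (r, n))) summable_on {1..} \<times> bottom_rows"
    using abs by (subst (asm) summable_on_swap) (simp add: case_prod_unfold)
  have absP: "(\<lambda>r. norm (1 / cocycle r z ^ 12 * qexp (coset_act r z) ^ N)) summable_on bottom_rows" for N
  proof (rule summable_on_comparison_test[OF summable_cocycle[OF z, of 12]], goal_cases)
    case (2 r)
    have "norm (qexp (coset_act r z)) ^ N \<le> 1"
      using norm_qexp_less_1[OF coset_act_props(3)[OF z 2]] by (intro power_le_one) auto
    then show ?case unfolding norm_mult norm_power by (intro mult_left_le) auto
  qed auto
  have col: "((\<lambda>r. G (r, n)) has_sum of_nat (divisor_sigma n) * Poincare 12 (n + m) z) bottom_rows" for n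
    using has_sum_cmult_right[OF has_sum_infsum[OF abs_summable_summable[OF absP[of "n + m"]]], of "of_nat (divisor_sigma n)"]
    by (simp add: G_def Poincare_def mult_ac)
  have abscol: "(\<lambda>r. norm (G (r, n))) summable_on bottom_rows" if "n \<in> {1..}" for n
    using summable_on_SigmaD1[OF abs' that] .
  have "(\<lambda>n. \<Sum>\<^sub>\<infinity>r\<in>bottom_rows. norm (G (r, n))) summable_on {1..}"
    using summable_on_Sigma_banach[OF abs'] by simp
  then show "(\<lambda>n. norm (of_nat (divisor_sigma n) * Poincare 12 (n + m) z)) summable_on {1..}"
  proof (rule summable_on_comparison_test, goal_cases)
    case (1 n)
    show ?case using norm_infsum_bound[OF abscol[OF 1]] infsumI[OF col[of n]] by simp
  qed auto
  obtain T where T: "(G has_sum T) (bottom_rows \<times> {1..})"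
    using abs_summable_summable[OF abs] by (auto simp: summable_on_def)
  then have "((\<lambda>(n, r). G (r, n)) has_sum T) ({1..} \<times> bottom_rows)"
    by (subst (asm) has_sum_swap) (simp add: case_prod_unfold)
  then have "((\<lambda>n. of_nat (divisor_sigma n) * Poincare 12 (n + m) z) has_sum T) {1..}"
    by (rule has_sum_SigmaD) (use col in simp)
  then have T_eq: "(\<Sum>\<^sub>\<infinity>n\<in>{1..}. of_nat (divisor_sigma n) * Poincare 12 (n + m) z) = T" by (rule infsumI)
  have row: "((\<lambda>r. 1 / cocycle r z ^ 12 * qexp (coset_act r z) ^ m * sigma_series (coset_act r z)) has_sum T) bottom_rows"
  proof (rule has_sum_SigmaD[OF T])
    fix r assume r: "r \<in> bottom_rows"
    from has_sum_cmult_right[OF has_sum_sigma_series[OF coset_act_props(3)[OF z r]], of "1 / cocycle r z ^ 12 * qexp (coset_act r z) ^ m"]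
    show "((\<lambda>n. G (r, n)) has_sum 1 / cocycle r z ^ 12 * qexp (coset_act r z) ^ m * sigma_series (coset_act r z)) {1..}"
      by (simp add: G_def power_add mult_ac)
  qed
  let ?P = "Poincare 12 m z"
  have P12: "((\<lambda>r. 1 / cocycle r z ^ 12 * qexp (coset_act r z) ^ m) has_sum ?P) bottom_rows"
    unfolding Poincare_def by (rule has_sum_infsum[OF abs_summable_summable[OF absP]])
  have lhs: "((\<lambda>r. 1 / cocycle r z ^ 12 * qexp (coset_act r z) ^ m + (- 24) * (1 / cocycle r z ^ 12 * qexp (coset_act r z) ^ m * sigma_series (coset_act r z)))
      has_sum (?P + (- 24) * T)) bottom_rows"
    by (intro has_sum_add has_sum_cmult_right P12 row)
  have absn: "(\<lambda>r. norm (A r * qexp (coset_act r z) ^ m)) summable_on bottom_rows"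
    if "(\<lambda>r. norm (A r)) summable_on bottom_rows" for A
    using that
  proof (rule summable_on_comparison_test, goal_cases)
    case (1 r)
    have "norm (qexp (coset_act r z)) ^ m \<le> 1"
      using norm_qexp_less_1[OF coset_act_props(3)[OF z 1]] by (intro power_le_one) auto
    then show ?case unfolding norm_mult norm_power by (intro mult_left_le) auto
  qed auto
  have "((\<lambda>r. 1 / cocycle r z ^ 10 * qexp (coset_act r z) ^ m) has_sum 0) bottom_rows"
    using has_sum_infsum[OF abs_summable_summable[OF absn[OF summable_cocycle[OF z, of 10]]]] Poincare_10_eq_0[OF z m]
    by (simp add: Poincare_def)
  moreover have "((\<lambda>r. of_int (fst r) / cocycle r z ^ 11 * qexp (coset_act r z) ^ m) has_sum (of_real pi * \<i> / 5 * of_nat m * ?P)) bottom_rows"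
    unfolding Poincare_deriv_eq[OF z m, symmetric] Poincare_deriv_def
    using has_sum_infsum[OF abs_summable_summable[OF absn[OF summable_deriv_cocycle[OF z, of 1]]]] by simp
  ultimately have rhs: "((\<lambda>r. E2 z * (1 / cocycle r z ^ 10 * qexp (coset_act r z) ^ m) +
       6 / (of_real pi * \<i>) * (of_int (fst r) / cocycle r z ^ 11 * qexp (coset_act r z) ^ m)) has_sum
       (E2 z * 0 + 6 / (of_real pi * \<i>) * (of_real pi * \<i> / 5 * of_nat m * ?P))) bottom_rows"
    by (intro has_sum_add has_sum_cmult_right)
  have eq: "1 / cocycle r z ^ 12 * qexp (coset_act r z) ^ m + (- 24) * (1 / cocycle r z ^ 12 * qexp (coset_act r z) ^ m * sigma_series (coset_act r z))
     = E2 z * (1 / cocycle r z ^ 10 * qexp (coset_act r z) ^ m) +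
       6 / (of_real pi * \<i>) * (of_int (fst r) / cocycle r z ^ 11 * qexp (coset_act r z) ^ m)" if r: "r \<in> bottom_rows" for r
  proof -
    define j u where "j = cocycle r z" "u = qexp (coset_act r z) ^ m"
    have j: "j \<noteq> 0" using coset_act_props(1)[OF z r] by (simp add: j_u_def)
    have "1 / j ^ 12 * u + (- 24) * (1 / j ^ 12 * u * sigma_series (coset_act r z)) = u / j ^ 12 * E2 (coset_act r z)"
      by (simp add: E2_def algebra_simps)
    also have "\<dots> = u / j ^ 12 * (j ^ 2 * E2 z) + u / j ^ 12 * (6 / (of_real pi * \<i>) * of_int (fst r) * j)"
      unfolding E2_coset_act[OF z r] j_u_def by (rule distrib_left)
    also have "u / j ^ 12 * (j ^ 2 * E2 z) = E2 z * (1 / j ^ 10 * u)"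
    proof -
      have e: "j ^ 12 = j ^ 10 * j ^ 2" by (simp flip: power_add)
      show ?thesis unfolding e using j by (simp add: divide_simps)
    qed
    also have "u / j ^ 12 * (6 / (of_real pi * \<i>) * of_int (fst r) * j) = 6 / (of_real pi * \<i>) * (of_int (fst r) / j ^ 11 * u)"
    proof -
      have e: "j ^ 12 = j ^ 11 * j" by (simp flip: power_Suc2)
      show ?thesis unfolding e using j by (simp add: divide_simps)
    qed
    finally show ?thesis by (simp only: j_u_def)
  qed
  have "?P + (- 24) * T = E2 z * 0 + 6 / (of_real pi * \<i>) * (of_real pi * \<i> / 5 * of_nat m * ?P)"
    using has_sum_unique[OF has_sum_cong[THEN iffD1, OF eq lhs] rhs] by simp
  then have *: "?P - 24 * T = 6 / 5 * of_nat m * ?P" by simp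
  have "20 * T = 5 / 6 * (?P - (?P - 24 * T))" by simp
  also have "\<dots> = (5 / 6 - of_nat m) * ?P" unfolding * by (simp add: algebra_simps)
  finally have "20 * T = (5 / 6 - of_nat m) * ?P" .
  then show "20 * (\<Sum>\<^sub>\<infinity>n\<in>{1..}. of_nat (divisor_sigma n) * Poincare 12 (n + m) z) = (5 / 6 - of_nat m) * ?P"
    unfolding T_eq .
qed

section \<open>Ramanujan's tau function\<close>

lemma exp_power_qexp: "exp (2 * of_real pi * \<i> * z) ^ n = qexp z ^ n"
  by (simp add: qexp_def)

text \<open>
  Existence is the modularity of \<Delta>, and uniqueness is the classification of cusp forms of weight 12.
\<close>

theorem ramanujan_tau_eq: "ramanujan_tau = Delta_coeff"
  unfolding ramanujan_tau_def
proof (rule the_equality)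
  have q: "has_q_expansion Delta Delta_coeff"
    unfolding has_q_expansion_def exp_power_qexp
    using Delta_q_sums norm_qexp_less_1 by (auto simp: upper_half_plane_def Delta_def)
  have "Delta holomorphic_on upper_half_plane"
    using has_field_derivative_Delta by (intro holomorphic_onI)
      (auto simp: upper_half_plane_def field_differentiable_def intro: has_field_derivative_at_within)
  then have "modular_form 12 Delta"
    using q Delta_modular by (auto simp: modular_form_def upper_half_plane_def)
  then show "\<exists>f. normalized_cusp_form 12 f Delta_coeff"
    using q Delta_coeff_0 Delta_coeff_1 by (auto simp: normalized_cusp_form_def)
next
  fix a assume "\<exists>f. normalized_cusp_form 12 f a"
  then obtain f where f: "modular_form 12 f" "has_q_expansion f a" "a 0 = 0" "a 1 = 1"
    by (auto simp: normalized_cusp_form_def)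
  have s: "(\<lambda>n. a (Suc n) * qexp z ^ Suc n) sums f z" if "Im z > 0" for z
    using f(2,3) that sums_Suc_iff[of "\<lambda>n. a n * qexp z ^ n" "f z"]
    unfolding has_q_expansion_def exp_power_qexp upper_half_plane_def by simp
  have S: "f (- 1 / z) = z ^ 12 * f z" if z: "Im z > 0" for z
  proof -
    have "\<forall>a b c d :: int. a * d - b * c = 1 \<longrightarrow>
        (\<forall>z\<in>upper_half_plane.
           f ((of_int a * z + of_int b) / (of_int c * z + of_int d)) = (of_int c * z + of_int d) powi 12 * f z)"
      using f(1) by (simp add: modular_form_def)
    from this[rule_format, of 0 0 "-1" 1 z] z show ?thesis by (simp add: upper_half_plane_def)
  qed
  have "a (Suc n) = Delta_coeff (Suc n)" for n
    using cusp_form_12(1)[of "\<lambda>n. a (Suc n)", OF s S, of n] f(4) by simp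
  then show "a = Delta_coeff" using f(3) Delta_coeff_0 by (metis ext not0_implies_Suc)
qed

theorem mainTheorem3:
  fixes m :: nat
  assumes "m \<ge> 1"
  shows "(\<lambda>n. norm (L_Delta_term m 11 n)) summable_on {1..} \<and>
         ramanujan_tau m = - 20 * of_nat m ^ 11 / (of_nat m - 5 / 6) * L_Delta m 11"
proof -
  define C where "C = Poincare 12 1 \<i>"
  have C: "C \<noteq> 0" using Poincare_12_1_nonzero by (simp add: C_def)
  have i: "Im \<i> > 0" by simp
  have P: "Poincare 12 N \<i> = C * (ramanujan_tau N / of_nat N ^ 11)" if "N \<ge> 1" for N
    using Poincare_12(1)[OF i that] that by (simp add: C_def ramanujan_tau_eq field_simps)
  have P': "of_nat (divisor_sigma n) * Poincare 12 (n + m) \<i> = C * L_Delta_term m 11 n" for n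
    using P[of "n + m"] assms by (simp add: L_Delta_term_def)
  have "(\<lambda>n. norm C * norm (L_Delta_term m 11 n)) summable_on {1..}"
    using Poincare_12_relation(1)[OF i assms] unfolding P' norm_mult .
  then have "(\<lambda>n. 1 / norm C * (norm C * norm (L_Delta_term m 11 n))) summable_on {1..}"
    by (rule summable_on_cmult_right)
  then have sm: "(\<lambda>n. norm (L_Delta_term m 11 n)) summable_on {1..}"
    using C by simp
  have "20 * (C * L_Delta m 11) = (5 / 6 - of_nat m) * (C * (ramanujan_tau m / of_nat m ^ 11))"
    using Poincare_12_relation(2)[OF i assms] unfolding P' P[OF assms] L_Delta_def
    by (simp add: infsum_cmult_right')
  then have "C * (20 * L_Delta m 11) = C * ((5 / 6 - of_nat m) * (ramanujan_tau m / of_nat m ^ 11))"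
    by (simp only: mult_ac)
  then have L: "20 * L_Delta m 11 = (5 / 6 - of_nat m) * (ramanujan_tau m / of_nat m ^ 11)"
    using C by (simp only: mult_cancel_left) simp
  have m0: "(of_nat m :: complex) - 5 / 6 \<noteq> 0" 
  proof
    assume "(of_nat m :: complex) - 5 / 6 = 0"
    then have "of_nat (6 * m) = (of_nat 5 :: complex)" by (simp add: field_simps)
    then have "6 * m = 5" by (simp only: of_nat_eq_iff)
    then show False by presburger
  qed
  have mm: "(of_nat m :: complex) ^ 11 \<noteq> 0" using assms by simp
  have "- 20 * of_nat m ^ 11 / (of_nat m - 5 / 6) * L_Delta m 11
      = - (of_nat m ^ 11 / (of_nat m - 5 / 6)) * (20 * L_Delta m 11)" by simp
  also have "\<dots> = - (of_nat m ^ 11 / (of_nat m - 5 / 6)) * (- (of_nat m - 5 / 6) * (ramanujan_tau m / of_nat m ^ 11))"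
    unfolding L by simp
  also have "\<dots> = ramanujan_tau m"
  proof -
    have "- (x / y) * (- y * (t / x)) = t" if "x \<noteq> 0" "y \<noteq> 0" for x y t :: complex
      using that by simp
    then show ?thesis using mm m0 by blast
  qed
  finally show ?thesis using sm by simp
qed

end
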